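(* Let $\Gamma$ be a Coxeter group with generating set $S$, Davis complex $X$ and set of walls $\mathcal W$. Let $\phi:\mathcal W\to F$ be a coloring by a finite set $F$ such that any two distinct walls of the same color do not intersect in $X$. Then there is a geometric resolution $\phi'$ of the tiling by coloring $\bar\phi$ that is strictly balanced and such that, additionally, every limit tiling of $\phi'$ is strictly balanced.
   Context: Coxeter groups: $\Gamma=\langle s_1,\dots,s_k\mid (s_is_j)^{m_{ij}}=1\rangle$, where $(m_{ij})$ is a symmetric matrix with $1$ on the diagonal and off-diagonal entries $0$ or integers $\ge 2$ ($a^0=1$, so $0$ means no relation); $S=\{s_1,\dots,s_k\}$. Davis complex: the nerve $N=N(\Gamma,S)$ is the simplicial complex with vertex set $S$ in which $s_{1},\dots,s_{j}$ span a simplex $\sigma$ iff they generate a finite subgroup $\Gamma_\sigma$. Let $N'$ be its barycentric subdivision and $C=\mathrm{Cone}(N')$ the chamber. The Davis complex $X$ is the quotient of $\Gamma\times C$ by the equivalence relation given on vertices by $a\times v_\sigma\sim b\times v_\sigma$ iff $a^{-1}b\in\Gamma_\sigma$, where $v_\sigma$ is the barycenter of $\sigma$; $C$ is identified with the image of $e\times C$ (the base chamber), $\Gamma$ acts on $X$, and $X$ is the union of the chambers $\gamma C$. For a reflection $r=wsw^{-1}$ ($w\in\Gamma$, $s\in S$), the wall $M_r$ is its fixed point set in $X$; it divides $X$ into two components. $\mathcal W$ is the set of walls. The faces of the chamber $\gamma C$ are $\gamma C\cap\gamma sC$, $s\in S$; this face lies in the wall of $\gamma s\gamma^{-1}$.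 Tiling by coloring: a coloring $\phi:\mathcal W\to F$ with finite $F$ gives a tiling $\bar\phi$ of $X$ whose tiles are the chambers with each face colored by the color of the wall containing it. Geometric resolution: choose for each wall $M$ an orientation, i.e. declare one component of $X\setminus M$ to be left and the other right. In a chamber, a face lying in a wall $M$ of color $c$ receives the signed color $c_+$ if the interior of the chamber is left of $M$ and $c_-$ if it is right of $M$. The resulting tiling $\phi'$ of $X$ by chambers with signed colored faces, with opposition function $o(c_+)=c_-$, $o(c_-)=c_+$, is called a geometric resolution of $\bar\phi$ (or of $\phi$). Balance: the minimal set of tiles of a tiling consists of the tiles (chambers with their signed colored faces) and the face labels that actually occur in it. A weight function assigns to each occurring face label $f$ an integer $w(f)$ with $w(o(f))=-w(f)$, i.e. $w(c_-)=-w(c_+)$. A set of tiles is strictly balanced if for every nontrivial (not identically zero) weight function $w$ there are tiles $t_+,t_-$ in the set with $\sum_{f\in t_+}w(f)>0$ and $\sum_{f\in t_-}w(f)<0$ (sums over all faces of the tile). A tiling is strictly balanced if its minimal set of tiles is. Limit tilings: $\Gamma$ acts on tilings of $X$ by chambers with signed colored faces; a limit tiling of $\phi'$ is an element of the closure of the orbit $\Gamma\phi'$, where convergence $g_k\phi'\to\beta$ means that on every bounded ball of $X$ the tilings $g_k\phi'$ and $\beta$ coincide for all sufficiently large $k$. *)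

theory Defs
  imports "HOL-Analysis.Analysis" "HOL-Algebra.Generated_Groups"
begin

section \<open>Groups given by generators and relators\<close>

text \<open>A letter \<open>(x, True)\<close> stands for the generator \<open>x\<close>, and \<open>(x, False)\<close> for its inverse.
  Quotienting the words by the congruence below gives the free group on \<open>A\<close> modulo the normal
  closure of \<open>R\<close>.\<close>

type_synonym 'a word = "('a \<times> bool) list"

definition words :: "'a set \<Rightarrow> 'a word set" where
  "words A = lists (A \<times> UNIV)"

inductive_set pres_rel :: "'a set \<Rightarrow> 'a word set \<Rightarrow> ('a word \<times> 'a word) set"
  for A :: "'a set" and R :: "'a word set" where
  refl: "u \<in> words A \<Longrightarrow> (u, u) \<in> pres_rel A R"
| sym: "(u, v) \<in> pres_rel A R \<Longrightarrow> (v, u) \<in> pres_rel A R"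
| trans: "(u, v) \<in> pres_rel A R \<Longrightarrow> (v, w) \<in> pres_rel A R \<Longrightarrow> (u, w) \<in> pres_rel A R"
| cancel: "u \<in> words A \<Longrightarrow> v \<in> words A \<Longrightarrow> x \<in> A \<Longrightarrow>
    (u @ [(x, b), (x, \<not> b)] @ v, u @ v) \<in> pres_rel A R"
| relator: "u \<in> words A \<Longrightarrow> v \<in> words A \<Longrightarrow> r \<in> R \<Longrightarrow> r \<in> words A \<Longrightarrow>
    (u @ r @ v, u @ v) \<in> pres_rel A R"

definition presented_group :: "'a set \<Rightarrow> 'a word set \<Rightarrow> 'a word set monoid" where
  "presented_group A R =
    \<lparr>carrier = words A // pres_rel A R,
     mult = (\<lambda>X Y. \<Union>x\<in>X. \<Union>y\<in>Y. pres_rel A R `` {x @ y}),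
     one = pres_rel A R `` {[]}\<rparr>"


section \<open>Coxeter groups\<close>

text \<open>The generators are indexed by \<open>{..<k}\<close>. An entry \<open>m i j = 0\<close> yields the empty relator,
  that is, no relation.\<close>

definition coxeter_matrix :: "nat \<Rightarrow> (nat \<Rightarrow> nat \<Rightarrow> nat) \<Rightarrow> bool" where
  "coxeter_matrix k m \<longleftrightarrow>
    (\<forall>i<k. m i i = 1) \<and>
    (\<forall>i<k. \<forall>j<k. m i j = m j i) \<and>
    (\<forall>i<k. \<forall>j<k. i \<noteq> j \<longrightarrow> m i j = 0 \<or> m i j \<ge> 2)"

definition coxeter_relators :: "nat \<Rightarrow> (nat \<Rightarrow> nat \<Rightarrow> nat) \<Rightarrow> nat word set" where
  "coxeter_relators k m =
    {concat (replicate (m i j) [(i, True), (j, True)]) | i j. i < k \<and> j < k}"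

definition coxeter_group :: "nat \<Rightarrow> (nat \<Rightarrow> nat \<Rightarrow> nat) \<Rightarrow> nat word set monoid" where
  "coxeter_group k m = presented_group {..<k} (coxeter_relators k m)"

definition coxeter_gens :: "nat \<Rightarrow> (nat \<Rightarrow> nat \<Rightarrow> nat) \<Rightarrow> nat word set set" where
  "coxeter_gens k m = (\<lambda>i. pres_rel {..<k} (coxeter_relators k m) `` {[(i, True)]}) ` {..<k}"


section \<open>Simplicial complexes\<close>

text \<open>A complex is given by the set of its (nonempty, finite) simplices.\<close>

definition barycentric_subdivision :: "'v set set \<Rightarrow> 'v set set set" where
  "barycentric_subdivision K = {\<tau>. \<tau> \<noteq> {} \<and> finite \<tau> \<and> \<tau> \<subseteq> K \<and> chain\<^sub>\<subseteq> \<tau>}"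

definition cone :: "'v \<Rightarrow> 'v set set \<Rightarrow> 'v set set" where
  "cone a K = K \<union> {{a}} \<union> insert a ` K"

definition supp :: "('v \<Rightarrow> real) \<Rightarrow> 'v set" where
  "supp x = {v. x v \<noteq> 0}"

text \<open>Points are given by barycentric coordinates. For the finite complexes occurring here, the
  topology induced from the product topology on \<open>'v \<Rightarrow> real\<close> is the usual one.\<close>

definition realization :: "'v set set \<Rightarrow> ('v \<Rightarrow> real) set" where
  "realization K = {x. (\<forall>v. 0 \<le> x v) \<and> supp x \<in> K \<and> sum x (supp x) = 1}"


section \<open>The Davis complex\<close>

definition nerve :: "('g, 'b) monoid_scheme \<Rightarrow> 'g set \<Rightarrow> 'g set set" where
  "nerve G S = {\<sigma>. \<sigma> \<subseteq> S \<and> \<sigma> \<noteq> {} \<and> finite \<sigma> \<and> finite (generate G \<sigma>)}"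

text \<open>The barycenter of a simplex \<open>\<sigma>\<close> of the nerve is the vertex \<open>\<sigma>\<close> of its subdivision.
  The cone point is the vertex \<open>{}\<close>, and \<open>generate G {}\<close> is the trivial group.\<close>

definition chamber_complex :: "('g, 'b) monoid_scheme \<Rightarrow> 'g set \<Rightarrow> 'g set set set" where
  "chamber_complex G S = cone {} (barycentric_subdivision (nerve G S))"

definition model_chamber :: "('g, 'b) monoid_scheme \<Rightarrow> 'g set \<Rightarrow> ('g set \<Rightarrow> real) set" where
  "model_chamber G S = realization (chamber_complex G S)"

text \<open>The identification of the vertices \<open>(a, \<sigma>)\<close> and \<open>(b, \<sigma>)\<close> when \<open>inv a \<otimes> b\<close> lies in
  \<open>generate G \<sigma>\<close> is extended linearly to the simplices: points are identified if they have the same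
  barycentric coordinates with respect to identified vertices.\<close>

definition davis_rel :: "('g, 'b) monoid_scheme \<Rightarrow> 'g set \<Rightarrow>
    (('g \<times> ('g set \<Rightarrow> real)) \<times> ('g \<times> ('g set \<Rightarrow> real))) set" where
  "davis_rel G S = {((a, x), (b, y)). a \<in> carrier G \<and> b \<in> carrier G \<and>
     x \<in> model_chamber G S \<and> y \<in> model_chamber G S \<and>
     x = y \<and> (\<forall>\<sigma>\<in>supp x. inv\<^bsub>G\<^esub> a \<otimes>\<^bsub>G\<^esub> b \<in> generate G \<sigma>)}"

type_synonym 'g davis_point = "('g \<times> ('g set \<Rightarrow> real)) set"

definition davis_complex :: "('g, 'b) monoid_scheme \<Rightarrow> 'g set \<Rightarrow> 'g davis_point set" where
  "davis_complex G S = (carrier G \<times> model_chamber G S) // davis_rel G S"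

definition davis_proj :: "('g, 'b) monoid_scheme \<Rightarrow> 'g set \<Rightarrow>
    'g \<times> ('g set \<Rightarrow> real) \<Rightarrow> 'g davis_point" where
  "davis_proj G S p = davis_rel G S `` {p}"

definition davis_cover :: "('g, 'b) monoid_scheme \<Rightarrow> 'g set \<Rightarrow>
    ('g \<times> ('g set \<Rightarrow> real)) topology" where
  "davis_cover G S =
    prod_topology (discrete_topology (carrier G)) (top_of_set (model_chamber G S))"

text \<open>The quotient topology.\<close>

definition davis_topology :: "('g, 'b) monoid_scheme \<Rightarrow> 'g set \<Rightarrow> 'g davis_point topology" where
  "davis_topology G S = topology (\<lambda>U. U \<subseteq> davis_complex G S \<and>
     openin (davis_cover G S) {p \<in> topspace (davis_cover G S). davis_proj G S p \<in> U})"

lemma openin_davis_topology: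
  "openin (davis_topology G S) U \<longleftrightarrow> U \<subseteq> davis_complex G S \<and>
     openin (davis_cover G S) {p \<in> topspace (davis_cover G S). davis_proj G S p \<in> U}"
proof -
  let ?T = "davis_cover G S" and ?q = "davis_proj G S" and ?X = "davis_complex G S"
  have "istopology (\<lambda>U. U \<subseteq> ?X \<and> openin ?T {p \<in> topspace ?T. ?q p \<in> U})"
    unfolding istopology_def
  proof (intro conjI allI impI)
    fix U V assume U: "U \<subseteq> ?X \<and> openin ?T {p \<in> topspace ?T. ?q p \<in> U}"
      and V: "V \<subseteq> ?X \<and> openin ?T {p \<in> topspace ?T. ?q p \<in> V}"
    have "{p \<in> topspace ?T. ?q p \<in> U \<inter> V} =
        {p \<in> topspace ?T. ?q p \<in> U} \<inter> {p \<in> topspace ?T. ?q p \<in> V}" by auto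
    then show "openin ?T {p \<in> topspace ?T. ?q p \<in> U \<inter> V}" using U V by auto
    show "U \<inter> V \<subseteq> ?X" using U by auto
  next
    fix \<U> assume *: "\<forall>U\<in>\<U>. U \<subseteq> ?X \<and> openin ?T {p \<in> topspace ?T. ?q p \<in> U}"
    have "{p \<in> topspace ?T. ?q p \<in> \<Union>\<U>} = (\<Union>U\<in>\<U>. {p \<in> topspace ?T. ?q p \<in> U})" by auto
    then show "openin ?T {p \<in> topspace ?T. ?q p \<in> \<Union>\<U>}" using * by auto
    show "\<Union>\<U> \<subseteq> ?X" using * by auto
  qed
  then show ?thesis unfolding davis_topology_def by simp
qed

definition davis_act :: "('g, 'b) monoid_scheme \<Rightarrow> 'g \<Rightarrow> 'g davis_point \<Rightarrow> 'g davis_point" where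
  "davis_act G g P = (\<lambda>(a, x). (g \<otimes>\<^bsub>G\<^esub> a, x)) ` P"

definition chamber :: "('g, 'b) monoid_scheme \<Rightarrow> 'g set \<Rightarrow> 'g \<Rightarrow> 'g davis_point set" where
  "chamber G S \<gamma> = (\<lambda>x. davis_proj G S (\<gamma>, x)) ` model_chamber G S"

definition reflections :: "('g, 'b) monoid_scheme \<Rightarrow> 'g set \<Rightarrow> 'g set" where
  "reflections G S = {w \<otimes>\<^bsub>G\<^esub> s \<otimes>\<^bsub>G\<^esub> inv\<^bsub>G\<^esub> w | w s. w \<in> carrier G \<and> s \<in> S}"

definition wall :: "('g, 'b) monoid_scheme \<Rightarrow> 'g set \<Rightarrow> 'g \<Rightarrow> 'g davis_point set" where
  "wall G S r = {P \<in> davis_complex G S. davis_act G r P = P}"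

definition walls :: "('g, 'b) monoid_scheme \<Rightarrow> 'g set \<Rightarrow> 'g davis_point set set" where
  "walls G S = wall G S ` reflections G S"

text \<open>The wall containing the face \<open>chamber G S \<gamma> \<inter> chamber G S (\<gamma> \<otimes> s)\<close> of \<open>chamber G S \<gamma>\<close>.\<close>

definition face_wall :: "('g, 'b) monoid_scheme \<Rightarrow> 'g set \<Rightarrow> 'g \<Rightarrow> 'g \<Rightarrow> 'g davis_point set" where
  "face_wall G S \<gamma> s = wall G S (\<gamma> \<otimes>\<^bsub>G\<^esub> s \<otimes>\<^bsub>G\<^esub> inv\<^bsub>G\<^esub> \<gamma>)"


subsection \<open>Metric\<close>

text \<open>The piecewise Euclidean length metric: the infimum of the lengths of strings of points in which
  consecutive points lie in a common simplex. Each simplex carries the Euclidean metric of the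
  standard simplex. Only the resulting notion of a bounded ball is used.\<close>

inductive davis_string :: "('g, 'b) monoid_scheme \<Rightarrow> 'g set \<Rightarrow>
    'g davis_point \<Rightarrow> 'g davis_point \<Rightarrow> real \<Rightarrow> bool"
  for G :: "('g, 'b) monoid_scheme" and S :: "'g set" where
  start: "P \<in> davis_complex G S \<Longrightarrow> davis_string G S P P 0"
| step: "davis_string G S P (davis_proj G S (\<gamma>, x)) l \<Longrightarrow> \<gamma> \<in> carrier G \<Longrightarrow>
    x \<in> model_chamber G S \<Longrightarrow> y \<in> model_chamber G S \<Longrightarrow>
    supp x \<union> supp y \<in> chamber_complex G S \<Longrightarrow>
    davis_string G S P (davis_proj G S (\<gamma>, y))
      (l + L2_set (\<lambda>\<sigma>. x \<sigma> - y \<sigma>) (supp x \<union> supp y))"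

definition davis_dist :: "('g, 'b) monoid_scheme \<Rightarrow> 'g set \<Rightarrow>
    'g davis_point \<Rightarrow> 'g davis_point \<Rightarrow> real" where
  "davis_dist G S P Q = Inf {l. davis_string G S P Q l}"

definition davis_ball :: "('g, 'b) monoid_scheme \<Rightarrow> 'g set \<Rightarrow>
    'g davis_point \<Rightarrow> real \<Rightarrow> 'g davis_point set" where
  "davis_ball G S P \<rho> = {Q \<in> davis_complex G S. davis_dist G S P Q \<le> \<rho>}"


section \<open>Tilings by chambers with labeled faces\<close>

text \<open>A tiling is encoded by the function assigning to \<open>\<gamma> \<in> carrier G\<close> and \<open>s \<in> S\<close> the label of the
  face \<open>chamber G S \<gamma> \<inter> chamber G S (\<gamma> \<otimes> s)\<close> of the chamber \<open>chamber G S \<gamma>\<close>. Only the values at such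
  \<open>\<gamma>\<close> and \<open>s\<close> matter. A tile is the labeling of the faces of one chamber, hence a function on \<open>S\<close>.\<close>

type_synonym ('g, 'l) tiling = "'g \<Rightarrow> 'g \<Rightarrow> 'l"

definition coloring_tiling :: "('g, 'b) monoid_scheme \<Rightarrow> 'g set \<Rightarrow>
    ('g davis_point set \<Rightarrow> 'c) \<Rightarrow> ('g, 'c) tiling" where
  "coloring_tiling G S \<phi> \<gamma> s = \<phi> (face_wall G S \<gamma> s)"

datatype 'c signed = Plus 'c | Minus 'c

fun opp :: "'c signed \<Rightarrow> 'c signed" where
  "opp (Plus c) = Minus c"
| "opp (Minus c) = Plus c"

definition wall_orientation :: "('g, 'b) monoid_scheme \<Rightarrow> 'g set \<Rightarrow>
    ('g davis_point set \<Rightarrow> 'g davis_point set) \<Rightarrow>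
    ('g davis_point set \<Rightarrow> 'g davis_point set) \<Rightarrow> bool" where
  "wall_orientation G S left right \<longleftrightarrow> (\<forall>M\<in>walls G S. left M \<noteq> right M \<and>
     connected_components_of (subtopology (davis_topology G S) (davis_complex G S - M)) =
       {left M, right M})"

definition geometric_resolution :: "('g, 'b) monoid_scheme \<Rightarrow> 'g set \<Rightarrow>
    ('g davis_point set \<Rightarrow> 'c) \<Rightarrow> ('g, 'c signed) tiling \<Rightarrow> bool" where
  "geometric_resolution G S \<phi> \<beta> \<longleftrightarrow> (\<exists>left right. wall_orientation G S left right \<and>
     (\<forall>\<gamma>\<in>carrier G. \<forall>s\<in>S.
        davis_topology G S interior_of chamber G S \<gamma> \<subseteq> left (face_wall G S \<gamma> s) \<and>
          \<beta> \<gamma> s = Plus (coloring_tiling G S \<phi> \<gamma> s) \<or>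
        davis_topology G S interior_of chamber G S \<gamma> \<subseteq> right (face_wall G S \<gamma> s) \<and>
          \<beta> \<gamma> s = Minus (coloring_tiling G S \<phi> \<gamma> s)))"


subsection \<open>Balance\<close>

definition tiles_of :: "('g, 'b) monoid_scheme \<Rightarrow> 'g set \<Rightarrow> ('g, 'l) tiling \<Rightarrow> ('g \<Rightarrow> 'l) set" where
  "tiles_of G S \<beta> = (\<lambda>\<gamma>. restrict (\<beta> \<gamma>) S) ` carrier G"

definition labels_of :: "'g set \<Rightarrow> ('g \<Rightarrow> 'l) set \<Rightarrow> 'l set" where
  "labels_of S T = (\<Union>t\<in>T. t ` S)"

definition weight_function :: "'c signed set \<Rightarrow> ('c signed \<Rightarrow> int) \<Rightarrow> bool" where
  "weight_function L w \<longleftrightarrow> (\<forall>f\<in>L. w (opp f) = - w f)"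

definition strictly_balanced :: "'g set \<Rightarrow> ('g \<Rightarrow> 'c signed) set \<Rightarrow> bool" where
  "strictly_balanced S T \<longleftrightarrow>
    (\<forall>w. weight_function (labels_of S T) w \<and> (\<exists>f\<in>labels_of S T. w f \<noteq> 0) \<longrightarrow>
      (\<exists>t\<in>T. (\<Sum>s\<in>S. w (t s)) > 0) \<and> (\<exists>t\<in>T. (\<Sum>s\<in>S. w (t s)) < 0))"

definition strictly_balanced_tiling :: "('g, 'b) monoid_scheme \<Rightarrow> 'g set \<Rightarrow>
    ('g, 'c signed) tiling \<Rightarrow> bool" where
  "strictly_balanced_tiling G S \<beta> \<longleftrightarrow> strictly_balanced S (tiles_of G S \<beta>)"


subsection \<open>Limit tilings\<close>

definition tiling_act :: "('g, 'b) monoid_scheme \<Rightarrow> 'g \<Rightarrow> ('g, 'l) tiling \<Rightarrow> ('g, 'l) tiling" where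
  "tiling_act G g \<beta> = (\<lambda>\<gamma> s. \<beta> (inv\<^bsub>G\<^esub> g \<otimes>\<^bsub>G\<^esub> \<gamma>) s)"

text \<open>Tilings coincide on a set if all chambers meeting that set carry the same labels.\<close>

definition coincide_on :: "('g, 'b) monoid_scheme \<Rightarrow> 'g set \<Rightarrow> 'g davis_point set \<Rightarrow>
    ('g, 'l) tiling \<Rightarrow> ('g, 'l) tiling \<Rightarrow> bool" where
  "coincide_on G S B \<alpha> \<beta> \<longleftrightarrow>
    (\<forall>\<gamma>\<in>carrier G. chamber G S \<gamma> \<inter> B \<noteq> {} \<longrightarrow> (\<forall>s\<in>S. \<alpha> \<gamma> s = \<beta> \<gamma> s))"

definition tiling_converges :: "('g, 'b) monoid_scheme \<Rightarrow> 'g set \<Rightarrow>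
    (nat \<Rightarrow> ('g, 'l) tiling) \<Rightarrow> ('g, 'l) tiling \<Rightarrow> bool" where
  "tiling_converges G S \<alpha> \<beta> \<longleftrightarrow> (\<forall>P\<in>davis_complex G S. \<forall>\<rho>.
     \<forall>\<^sub>F n in sequentially. coincide_on G S (davis_ball G S P \<rho>) (\<alpha> n) \<beta>)"

definition limit_tiling :: "('g, 'b) monoid_scheme \<Rightarrow> 'g set \<Rightarrow>
    ('g, 'l) tiling \<Rightarrow> ('g, 'l) tiling \<Rightarrow> bool" where
  "limit_tiling G S \<alpha> \<beta> \<longleftrightarrow> (\<exists>g :: nat \<Rightarrow> 'g. (\<forall>n. g n \<in> carrier G) \<and>
     tiling_converges G S (\<lambda>n. tiling_act G (g n) \<alpha>) \<beta>)"

end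

theory Submission
  imports Defs "HOL-Combinatorics.Transposition"
begin

text \<open>
  Fix a color. Its walls are pairwise disjoint, so they cut the Davis complex into regions whose
  dual graph is a tree. Such a tree is bipartite, and the resolution orients each wall towards the
  region at even or odd distance from the base chamber in a uniform way: a chamber carries the sign
  \<open>+\<close> at all its faces of color \<open>c\<close> or \<open>-\<close> at all of them, according to the parity of the
  number of walls of color \<open>c\<close> between it and the base chamber (\<open>exists_parity_resolution\<close>).

  Given weights, add up over all colors the weight \<open>w (Plus c)\<close> if the parity of \<open>c\<close> at the
  chamber is the upper one. This height function takes finitely many values, and the weight of a
  face is the drop of height across it. At a highest chamber all face weights are nonnegative, and if
  the heights are not constant, then some highest chamber has a positive one; lowest chambers give
  negative tiles. The version \<open>exists_positive_tile\<close> of this argument looks at one finite path of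
  chambers only. It therefore also applies to limit tilings, which agree with a translate of the
  resolution on every finite set of chambers (\<open>limit_tiling_coincides_on_finite\<close>).

  What remains is geometry: that walls have two sides, that these are the components of the
  complement, and that walls of the same color do not separate chambers touching one side of a given
  wall of that color. The source of all this is a homotopy argument in the Cayley
  complex. Let crossing a wall apply a permutation of order at most two that depends on the wall. If
  each finite dihedral residue meets at most one wall with a nontrivial permutation, then the
  relators of the Coxeter presentation act trivially, and the effect of a gallery depends only on its end
  points (\<open>word_transport_cong\<close>). A single transposition at one wall gives the two sides, a
  transposition at all walls of one color gives the parity above, and two noncommuting
  transpositions, one for a chosen wall and one for the others of its color, give the separation
  statement (\<open>parity_constant_along_wall\<close>). Reflecting parts of galleries shows that chambers on
  the same side of a wall are joined without crossing it (\<open>same_side_induct\<close>), and from this follows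
  that the halfspaces are the components of the complement (\<open>connected_components_off_wall\<close>).\<close>

section \<open>Groups given by generators and relators\<close>

lemma Nil_in_words [simp]: "[] \<in> words A"
  by (simp add: words_def)

lemma Cons_in_words [simp]: "(x, b) # u \<in> words A \<longleftrightarrow> x \<in> A \<and> u \<in> words A"
  by (auto simp: words_def)

lemma append_in_words [simp]: "u @ v \<in> words A \<longleftrightarrow> u \<in> words A \<and> v \<in> words A"
  by (auto simp: words_def)

lemma pres_rel_words: "(u, v) \<in> pres_rel A R \<Longrightarrow> u \<in> words A \<and> v \<in> words A"
  by (induction rule: pres_rel.induct) auto

lemma equiv_pres_rel: "equiv (words A) (pres_rel A R)"
  by (intro equivI refl_onI symI transI)
    (use pres_rel_words in \<open>auto intro: pres_rel.intros\<close>)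

lemma pres_rel_append_left:
  "(u, v) \<in> pres_rel A R \<Longrightarrow> w \<in> words A \<Longrightarrow> (w @ u, w @ v) \<in> pres_rel A R"
proof (induction rule: pres_rel.induct)
  case (cancel u v x b)
  then show ?case using pres_rel.cancel[of "w @ u" A v x b R] by simp
next
  case (relator u v r)
  then show ?case using pres_rel.relator[of "w @ u" A v r R] by simp
qed (auto intro: pres_rel.intros)

lemma pres_rel_append_right:
  "(u, v) \<in> pres_rel A R \<Longrightarrow> w \<in> words A \<Longrightarrow> (u @ w, v @ w) \<in> pres_rel A R"
proof (induction rule: pres_rel.induct)
  case (cancel u v x b)
  then show ?case using pres_rel.cancel[of u A "v @ w" x b R] by simp
next
  case (relator u v r)
  then show ?case using pres_rel.relator[of u A "v @ w" r R] by simp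
qed (auto intro: pres_rel.intros)

abbreviation word_class :: "'a set \<Rightarrow> 'a word set \<Rightarrow> 'a word \<Rightarrow> 'a word set" where
  "word_class A R u \<equiv> pres_rel A R `` {u}"

lemma word_class_eq_iff:
  "u \<in> words A \<Longrightarrow> v \<in> words A \<Longrightarrow> word_class A R u = word_class A R v \<longleftrightarrow> (u, v) \<in> pres_rel A R"
  by (rule eq_equiv_class_iff[OF equiv_pres_rel])

lemma mult_word_class:
  assumes "u \<in> words A" "v \<in> words A"
  shows "word_class A R u \<otimes>\<^bsub>presented_group A R\<^esub> word_class A R v = word_class A R (u @ v)"
proof -
  have "word_class A R (x @ y) = word_class A R (u @ v)"
    if "(u, x) \<in> pres_rel A R" "(v, y) \<in> pres_rel A R" for x y
  proof -
    have "(u @ v, x @ y) \<in> pres_rel A R"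
      using pres_rel.trans[OF pres_rel_append_right[OF that(1) assms(2)]
          pres_rel_append_left[OF that(2)]] pres_rel_words[OF that(1)] by blast
    then show ?thesis by (metis equiv_pres_rel equiv_class_eq)
  qed
  then have "(\<Union>x\<in>word_class A R u. \<Union>y\<in>word_class A R v. word_class A R (x @ y))
    = (\<Union>x\<in>word_class A R u. \<Union>y\<in>word_class A R v. word_class A R (u @ v))"
    by auto
  also have "\<dots> = word_class A R (u @ v)"
    using assms by (auto intro: pres_rel.refl)
  finally show ?thesis by (simp add: presented_group_def)
qed

lemma carrier_presented_group:
  "X \<in> carrier (presented_group A R) \<longleftrightarrow> (\<exists>u\<in>words A. X = word_class A R u)"
  by (auto simp: presented_group_def quotient_def)

lemma word_class_in_carrier [simp]:
  "u \<in> words A \<Longrightarrow> word_class A R u \<in> carrier (presented_group A R)"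
  by (auto simp: carrier_presented_group)

lemma one_presented_group: "\<one>\<^bsub>presented_group A R\<^esub> = word_class A R []"
  by (simp add: presented_group_def)

lemma word_has_left_inverse:
  "u \<in> words A \<Longrightarrow> \<exists>v\<in>words A. (v @ u, []) \<in> pres_rel A R"
proof (induction u)
  case Nil
  show ?case by (rule bexI[of _ "[]"]) (auto intro: pres_rel.refl)
next
  case (Cons a u)
  obtain x b where a: "a = (x, b)" by force
  with Cons obtain v where v: "v \<in> words A" "(v @ u, []) \<in> pres_rel A R" by auto
  have "(v @ [(x, \<not> b), (x, \<not> \<not> b)] @ u, v @ u) \<in> pres_rel A R"
    using Cons a v by (intro pres_rel.cancel) auto
  then have "((v @ [(x, \<not> b)]) @ a # u, []) \<in> pres_rel A R"
    using a pres_rel.trans[OF _ v(2)] by simp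
  then show ?case using v Cons a by (intro bexI[of _ "v @ [(x, \<not> b)]"]) auto
qed

lemma group_presented_group: "group (presented_group A R)"
proof (rule groupI)
  fix X assume "X \<in> carrier (presented_group A R)"
  then obtain u where u: "u \<in> words A" "X = word_class A R u"
    by (auto simp: carrier_presented_group)
  then obtain v where "v \<in> words A" "(v @ u, []) \<in> pres_rel A R"
    using word_has_left_inverse by blast
  then show "\<exists>Y\<in>carrier (presented_group A R). Y \<otimes>\<^bsub>presented_group A R\<^esub> X = \<one>\<^bsub>presented_group A R\<^esub>"
    using u by (intro bexI[of _ "word_class A R v"])
      (auto simp: mult_word_class one_presented_group word_class_eq_iff)
qed (auto simp: carrier_presented_group mult_word_class one_presented_group)


section \<open>Transport along galleries\<close>

text \<open>
  What is used of the Coxeter presentation. Attach to each reflection \<open>r\<close> a permutation \<open>\<tau> r\<close> of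
  order at most two, and let the step of a gallery from \<open>\<gamma>\<close> to \<open>\<gamma> \<otimes> s\<close> apply the permutation of
  \<open>\<gamma> \<otimes> s \<otimes> inv \<gamma>\<close>, the reflection whose wall is crossed. The last axiom says that the
  composite along a gallery depends only on its end points, provided that around every
  finite dihedral residue at most one nontrivial permutation occurs. All separation properties of
  walls are drawn from this axiom by choosing suitable permutations.\<close>

locale gallery_group = group G for G (structure) +
  fixes S
  assumes finite_S: "finite S"
    and S_carrier: "S \<subseteq> carrier G"
    and S_square: "s \<in> S \<Longrightarrow> s \<otimes> s = \<one>"
    and generate_S: "generate G S = carrier G"
    and transport:
      "\<lbrakk>\<And>x. \<tau> x \<circ> \<tau> x = (id :: nat \<Rightarrow> nat);
        \<And>\<gamma> s t. \<lbrakk>\<gamma> \<in> carrier G; s \<in> S; t \<in> S; finite (generate G {s, t})\<rbrakk>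
          \<Longrightarrow> \<exists>a. \<forall>x\<in>generate G {s, t}. \<tau> (\<gamma> \<otimes> x \<otimes> inv \<gamma>) \<in> {id, a}\<rbrakk>
       \<Longrightarrow> \<exists>\<Phi>. \<Phi> \<one> = id \<and>
         (\<forall>\<gamma>\<in>carrier G. \<forall>s\<in>S. \<Phi> (\<gamma> \<otimes> s) = \<Phi> \<gamma> \<circ> \<tau> (\<gamma> \<otimes> s \<otimes> inv \<gamma>))"

lemma (in group) generate_right_induct [consumes 1, case_names subset square one step]:
  assumes "u \<in> generate G \<sigma>"
    and \<sigma>: "\<sigma> \<subseteq> carrier G" "\<And>s. s \<in> \<sigma> \<Longrightarrow> s \<otimes> s = \<one>"
    and one: "P \<one>" and step: "\<And>u s. u \<in> generate G \<sigma> \<Longrightarrow> s \<in> \<sigma> \<Longrightarrow> P u \<Longrightarrow> P (u \<otimes> s)"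
  shows "P u"
proof -
  have "\<forall>v\<in>generate G \<sigma>. P v \<longrightarrow> P (v \<otimes> u)"
    using assms(1)
  proof (induction rule: generate.induct)
    case one
    then show ?case using generate_in_carrier[OF \<sigma>(1)] by auto
  next
    case (incl h)
    then show ?case using step by auto
  next
    case (inv h)
    moreover from inv have "inv h = h" using \<sigma> by (auto intro: inv_equality)
    ultimately show ?case using step by auto
  next
    case (eng h1 h2)
    show ?case
    proof (intro ballI impI)
      fix v assume v: "v \<in> generate G \<sigma>" "P v"
      then have "P ((v \<otimes> h1) \<otimes> h2)" using eng by (auto intro: generate.eng)
      then show "P (v \<otimes> (h1 \<otimes> h2))"
        using v eng generate_in_carrier[OF \<sigma>(1)] by (simp add: m_assoc)
    qed
  qed
  from this[rule_format, OF generate.one one] show ?thesis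
    using generate_in_carrier[OF \<sigma>(1) assms(1)] by simp
qed

text \<open>The two generators of a dihedral group: with \<open>p = s \<otimes> t\<close>, the reflections met on the way
  along \<open>s, t, s, t, \<dots>\<close> are \<open>p [^] n \<otimes> s\<close>, and there are finitely many if \<open>p\<close> has finite order.\<close>

locale involution_pair = group G for G (structure) +
  fixes s t
  assumes st [simp]: "s \<in> carrier G" "t \<in> carrier G"
    and sq: "s \<otimes> s = \<one>" "t \<otimes> t = \<one>"
begin

abbreviation p where "p \<equiv> s \<otimes> t"

lemma s_cancel [simp]: "x \<in> carrier G \<Longrightarrow> x \<otimes> s \<otimes> s = x"
  using sq by (simp add: m_assoc)

lemma t_cancel [simp]: "x \<in> carrier G \<Longrightarrow> x \<otimes> t \<otimes> t = x"
  using sq by (simp add: m_assoc)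

lemma inv_s [simp]: "inv s = s" and inv_t [simp]: "inv t = t"
  using sq by (auto intro: inv_equality)

lemma s_inv_p: "s \<otimes> inv (p [^] n) = p [^] n \<otimes> s" for n :: nat
proof (induction n)
  case (Suc n)
  have "s \<otimes> inv (p [^] Suc n) = s \<otimes> inv (p \<otimes> p [^] n)"
    by (metis nat_pow_Suc2 m_closed st)
  also have "\<dots> = (s \<otimes> inv (p [^] n)) \<otimes> inv p"
    by (simp add: inv_mult_group m_assoc)
  also have "\<dots> = p [^] n \<otimes> (s \<otimes> inv p)" by (simp add: Suc m_assoc)
  also have "s \<otimes> inv p = p \<otimes> s" by (simp add: inv_mult_group m_assoc)
  finally show ?case by (simp add: m_assoc)
qed simp

lemma conj_s: "p [^] n \<otimes> s \<otimes> inv (p [^] n) = p [^] (2 * n) \<otimes> s" for n :: nat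
proof -
  have "p [^] n \<otimes> s \<otimes> inv (p [^] n) = p [^] n \<otimes> (p [^] n \<otimes> s)"
    by (simp add: m_assoc s_inv_p)
  also have "\<dots> = p [^] (2 * n) \<otimes> s"
    by (simp add: mult_2 flip: nat_pow_mult m_assoc)
  finally show ?thesis .
qed

lemma conj_t: "(p [^] n \<otimes> s) \<otimes> t \<otimes> inv (p [^] n \<otimes> s) = p [^] (2 * n + 1) \<otimes> s" for n :: nat
proof -
  have "(p [^] n \<otimes> s) \<otimes> t \<otimes> inv (p [^] n \<otimes> s) = p [^] n \<otimes> (p \<otimes> (s \<otimes> inv (p [^] n)))"
    by (simp add: inv_mult_group m_assoc)
  also have "\<dots> = p [^] n \<otimes> p \<otimes> p [^] n \<otimes> s"
    by (simp add: s_inv_p m_assoc)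
  also have "p [^] n \<otimes> p \<otimes> p [^] n = p [^] (2 * n + 1)"
  proof -
    have "p [^] n \<otimes> p \<otimes> p [^] n = p [^] (Suc n + n)"
      by (subst nat_pow_mult[symmetric]) auto
    then show ?thesis by (simp add: mult_2)
  qed
  finally show ?thesis .
qed

lemma p_pow_s_in: "p [^] n \<otimes> s \<in> generate G {s, t}" for n :: nat
proof -
  have "p [^] n \<in> generate G {s, t}"
    by (induction n) (auto intro: generate.intros)
  then show ?thesis by (auto intro: generate.intros)
qed

lemma p_pow_add_period: "p [^] (n + M) = p [^] n" if "p [^] M = \<one>" for n M :: nat
proof -
  have "p [^] (n + M) = p [^] n \<otimes> p [^] M" by (subst nat_pow_mult[symmetric]) auto
  then show ?thesis using that by simp
qed

lemma finite_generate_pair: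
  assumes M: "p [^] M = \<one>" "(M::nat) > 0"
  shows "finite (generate G {s, t})"
proof -
  let ?P = "(\<lambda>n::nat. p [^] n) ` {..<M}"
  have P: "p [^] n \<in> ?P" for n :: nat
  proof -
    have "p [^] n = p [^] (n mod M + (n div M) * M)" by simp
    also have "\<dots> = p [^] (n mod M)"
      using M by (subst nat_pow_mult[symmetric]) (auto simp: mult.commute simp flip: nat_pow_pow)
    finally show ?thesis using M by auto
  qed
  have "generate G {s, t} \<subseteq> ?P \<union> (\<lambda>x. x \<otimes> s) ` ?P"
  proof
    fix u assume "u \<in> generate G {s, t}"
    then show "u \<in> ?P \<union> (\<lambda>x. x \<otimes> s) ` ?P"
    proof (induction rule: generate_right_induct)
      case one
      then show ?case using P[of 0] by simp
    next
      case (step u v)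
      have 1: "p [^] n \<otimes> t \<in> (\<lambda>x. x \<otimes> s) ` ?P" for n :: nat
      proof -
        obtain M' where M': "M = Suc M'" using M by (cases M) auto
        have "p [^] n \<otimes> t = p [^] (n + M) \<otimes> t" using p_pow_add_period[OF M(1)] by simp
        also have "\<dots> = p [^] (n + M') \<otimes> s \<otimes> t \<otimes> t" by (simp add: M' m_assoc)
        also have "\<dots> = p [^] (n + M') \<otimes> s" by simp
        finally show ?thesis using P by blast
      qed
      have 2: "p [^] n \<otimes> s \<otimes> t \<in> ?P" for n :: nat
        using P[of "Suc n"] by (simp add: m_assoc)
      have 3: "p [^] n \<otimes> s \<otimes> s \<in> ?P" for n :: nat
        using P[of n] by simp
      from step 1 2 3 P show ?case by auto
    qed (use sq in auto)
  qed
  then show ?thesis by (rule finite_subset) auto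
qed

end


section \<open>Coxeter groups are gallery groups\<close>

primrec composite :: "('y \<Rightarrow> 'y) list \<Rightarrow> 'y \<Rightarrow> 'y" where
  "composite [] = id"
| "composite (f # fs) = f \<circ> composite fs"

lemma composite_append: "composite (xs @ ys) = composite xs \<circ> composite ys"
  by (induction xs) (auto simp: comp_assoc)

lemma composite_in_pair:
  assumes "a \<circ> a = id" "set xs \<subseteq> {id, a}"
  shows "composite xs \<in> {id, a}"
  using assms by (induction xs) auto

context
  fixes k :: nat and m :: "nat \<Rightarrow> nat \<Rightarrow> nat"
  assumes cox: "coxeter_matrix k m"
begin

abbreviation (input) "\<Gamma> \<equiv> coxeter_group k m"
abbreviation (input) "cls \<equiv> word_class {..<k} (coxeter_relators k m)"

interpretation group \<Gamma>
  unfolding coxeter_group_def by (rule group_presented_group)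

lemma cls_mult: "u \<in> words {..<k} \<Longrightarrow> v \<in> words {..<k} \<Longrightarrow> cls u \<otimes>\<^bsub>\<Gamma>\<^esub> cls v = cls (u @ v)"
  by (simp add: coxeter_group_def mult_word_class)

lemma cls_carrier [simp]: "u \<in> words {..<k} \<Longrightarrow> cls u \<in> carrier \<Gamma>"
  by (simp add: coxeter_group_def)

lemma cls_Nil: "cls [] = \<one>\<^bsub>\<Gamma>\<^esub>"
  by (simp add: coxeter_group_def one_presented_group)

lemma replicate_in_words:
  "i < k \<Longrightarrow> j < k \<Longrightarrow> concat (replicate n [(i, True), (j, True)]) \<in> words {..<k}"
  by (induction n) auto

lemma cls_relator:
  assumes "i < k" "j < k"
  shows "cls (concat (replicate (m i j) [(i, True), (j, True)])) = \<one>\<^bsub>\<Gamma>\<^esub>"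
proof -
  have "([] @ concat (replicate (m i j) [(i, True), (j, True)]) @ [], [] @ [])
      \<in> pres_rel {..<k} (coxeter_relators k m)"
    using assms replicate_in_words by (intro pres_rel.relator) (auto simp: coxeter_relators_def)
  then show ?thesis
    using replicate_in_words[OF assms] by (simp add: word_class_eq_iff flip: cls_Nil)
qed

lemma gen_square: "i < k \<Longrightarrow> cls [(i, True)] \<otimes>\<^bsub>\<Gamma>\<^esub> cls [(i, True)] = \<one>\<^bsub>\<Gamma>\<^esub>"
  using cls_relator[of i i] cox by (simp add: cls_mult coxeter_matrix_def)

text \<open>Since the generators are involutions, the sign of a letter can be ignored.\<close>

lemma cls_letter: "i < k \<Longrightarrow> cls [(i, b)] = cls [(i, True)]"
proof -
  assume i: "i < k"
  have "([] @ [(i, True), (i, \<not> True)] @ [], [] @ []) \<in> pres_rel {..<k} (coxeter_relators k m)"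
    using i by (intro pres_rel.cancel) auto
  then have "cls [(i, True)] \<otimes>\<^bsub>\<Gamma>\<^esub> cls [(i, False)] = \<one>\<^bsub>\<Gamma>\<^esub>"
    using i by (simp add: cls_mult word_class_eq_iff flip: cls_Nil)
  then have "cls [(i, False)] = cls [(i, True)]"
    using i gen_square[OF i] inv_equality
    by (metis cls_carrier Cons_in_words Nil_in_words lessThan_iff inv_inv)
  then show ?thesis by (cases b) auto
qed

lemma cls_power:
  assumes "i < k" "j < k"
  shows "cls (concat (replicate n [(i, True), (j, True)]))
    = (cls [(i, True)] \<otimes>\<^bsub>\<Gamma>\<^esub> cls [(j, True)]) [^]\<^bsub>\<Gamma>\<^esub> n"
proof (induction n)
  case 0
  then show ?case by (simp add: cls_Nil)
next
  case (Suc n)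
  have "cls (concat (replicate (Suc n) [(i, True), (j, True)]))
    = cls (concat (replicate n [(i, True), (j, True)]) @ [(i, True)] @ [(j, True)])"
    by (simp flip: replicate_append_same)
  also have "\<dots> = cls (concat (replicate n [(i, True), (j, True)])) \<otimes>\<^bsub>\<Gamma>\<^esub>
      (cls [(i, True)] \<otimes>\<^bsub>\<Gamma>\<^esub> cls [(j, True)])"
    using assms by (simp add: replicate_in_words cls_mult)
  finally show ?case by (simp add: Suc)
qed

lemma generate_coxeter_gens: "generate \<Gamma> (coxeter_gens k m) = carrier \<Gamma>"
proof
  show "generate \<Gamma> (coxeter_gens k m) \<subseteq> carrier \<Gamma>"
    by (rule generate_incl) (auto simp: coxeter_gens_def)
  have "cls u \<in> generate \<Gamma> (coxeter_gens k m)" if "u \<in> words {..<k}" for u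
    using that
  proof (induction u)
    case Nil
    then show ?case by (simp add: cls_Nil generate.one)
  next
    case (Cons a u)
    obtain i b where a: "a = (i, b)" by force
    have "cls (a # u) = cls [(i, True)] \<otimes>\<^bsub>\<Gamma>\<^esub> cls u"
      using Cons a by (simp add: cls_mult flip: cls_letter[of i b])
    moreover have "cls [(i, True)] \<in> coxeter_gens k m"
      using Cons a by (auto simp: coxeter_gens_def)
    ultimately show ?case using Cons a by (auto intro: generate.intros)
  qed
  then show "carrier \<Gamma> \<subseteq> generate \<Gamma> (coxeter_gens k m)"
    by (auto simp: coxeter_group_def carrier_presented_group)
qed

text \<open>The composite of the permutations crossed by the gallery that starts at \<open>\<gamma>\<close> and is spelled
  out by a word.\<close>

fun word_transport :: "(nat word set \<Rightarrow> 'y \<Rightarrow> 'y) \<Rightarrow> nat word set \<Rightarrow> nat word \<Rightarrow> 'y \<Rightarrow> 'y" where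
  "word_transport \<tau> \<gamma> [] = id"
| "word_transport \<tau> \<gamma> ((i, b) # u) =
    \<tau> (\<gamma> \<otimes>\<^bsub>\<Gamma>\<^esub> cls [(i, True)] \<otimes>\<^bsub>\<Gamma>\<^esub> inv\<^bsub>\<Gamma>\<^esub> \<gamma>) \<circ>
      word_transport \<tau> (\<gamma> \<otimes>\<^bsub>\<Gamma>\<^esub> cls [(i, True)]) u"

lemma word_transport_append:
  "u \<in> words {..<k} \<Longrightarrow> \<gamma> \<in> carrier \<Gamma> \<Longrightarrow>
    word_transport \<tau> \<gamma> (u @ v) = word_transport \<tau> \<gamma> u \<circ> word_transport \<tau> (\<gamma> \<otimes>\<^bsub>\<Gamma>\<^esub> cls u) v"
proof (induction u arbitrary: \<gamma>)
  case Nil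
  then show ?case by (simp add: cls_Nil)
next
  case (Cons a u)
  obtain i b where a: "a = (i, b)" by force
  have "cls (a # u) = cls [(i, True)] \<otimes>\<^bsub>\<Gamma>\<^esub> cls u"
    using Cons a by (simp add: cls_mult flip: cls_letter[of i b])
  then show ?case using Cons a by (simp add: comp_assoc m_assoc)
qed

lemma word_transport_power:
  fixes \<tau> :: "nat word set \<Rightarrow> 'y \<Rightarrow> 'y"
  assumes "i < k" "j < k" "\<gamma> \<in> carrier \<Gamma>"
  defines "s \<equiv> cls [(i, True)]" and "t \<equiv> cls [(j, True)]"
  shows "word_transport \<tau> \<gamma> (concat (replicate n [(i, True), (j, True)])) =
    composite (map (\<lambda>l. \<tau> (\<gamma> \<otimes>\<^bsub>\<Gamma>\<^esub> ((s \<otimes>\<^bsub>\<Gamma>\<^esub> t) [^]\<^bsub>\<Gamma>\<^esub> l \<otimes>\<^bsub>\<Gamma>\<^esub> s) \<otimes>\<^bsub>\<Gamma>\<^esub> inv\<^bsub>\<Gamma>\<^esub> \<gamma>))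
      [0..<2 * n])"
proof -
  interpret D: involution_pair \<Gamma> s t
    using assms by unfold_locales (auto simp: gen_square)
  show ?thesis
  proof (induction n)
    case (Suc n)
    let ?w = "concat (replicate n [(i, True), (j, True)])" and ?x = "\<gamma> \<otimes>\<^bsub>\<Gamma>\<^esub> D.p [^]\<^bsub>\<Gamma>\<^esub> n"
    let ?f = "\<lambda>l. \<tau> (\<gamma> \<otimes>\<^bsub>\<Gamma>\<^esub> (D.p [^]\<^bsub>\<Gamma>\<^esub> l \<otimes>\<^bsub>\<Gamma>\<^esub> s) \<otimes>\<^bsub>\<Gamma>\<^esub> inv\<^bsub>\<Gamma>\<^esub> \<gamma>)"
    have x: "?x \<in> carrier \<Gamma>" using assms by simp
    have 1: "?x \<otimes>\<^bsub>\<Gamma>\<^esub> s \<otimes>\<^bsub>\<Gamma>\<^esub> inv\<^bsub>\<Gamma>\<^esub> ?x = \<gamma> \<otimes>\<^bsub>\<Gamma>\<^esub> (D.p [^]\<^bsub>\<Gamma>\<^esub> (2 * n) \<otimes>\<^bsub>\<Gamma>\<^esub> s) \<otimes>\<^bsub>\<Gamma>\<^esub> inv\<^bsub>\<Gamma>\<^esub> \<gamma>"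
      using assms(3) unfolding D.conj_s[symmetric] by (simp add: inv_mult_group m_assoc)
    have 2: "?x \<otimes>\<^bsub>\<Gamma>\<^esub> s \<otimes>\<^bsub>\<Gamma>\<^esub> t \<otimes>\<^bsub>\<Gamma>\<^esub> inv\<^bsub>\<Gamma>\<^esub> (?x \<otimes>\<^bsub>\<Gamma>\<^esub> s)
        = \<gamma> \<otimes>\<^bsub>\<Gamma>\<^esub> (D.p [^]\<^bsub>\<Gamma>\<^esub> (2 * n + 1) \<otimes>\<^bsub>\<Gamma>\<^esub> s) \<otimes>\<^bsub>\<Gamma>\<^esub> inv\<^bsub>\<Gamma>\<^esub> \<gamma>"
      using assms(3) unfolding D.conj_t[symmetric] by (simp add: inv_mult_group m_assoc)
    have "word_transport \<tau> \<gamma> (concat (replicate (Suc n) [(i, True), (j, True)]))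
        = word_transport \<tau> \<gamma> (?w @ [(i, True), (j, True)])"
      by (simp flip: replicate_append_same)
    also have "\<dots> = word_transport \<tau> \<gamma> ?w \<circ> word_transport \<tau> ?x [(i, True), (j, True)]"
      using assms by (simp add: word_transport_append replicate_in_words cls_power)
    also have "word_transport \<tau> ?x [(i, True), (j, True)] =
      \<tau> (\<gamma> \<otimes>\<^bsub>\<Gamma>\<^esub> (D.p [^]\<^bsub>\<Gamma>\<^esub> (2 * n) \<otimes>\<^bsub>\<Gamma>\<^esub> s) \<otimes>\<^bsub>\<Gamma>\<^esub> inv\<^bsub>\<Gamma>\<^esub> \<gamma>) \<circ>
      \<tau> (\<gamma> \<otimes>\<^bsub>\<Gamma>\<^esub> (D.p [^]\<^bsub>\<Gamma>\<^esub> (2 * n + 1) \<otimes>\<^bsub>\<Gamma>\<^esub> s) \<otimes>\<^bsub>\<Gamma>\<^esub> inv\<^bsub>\<Gamma>\<^esub> \<gamma>)"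
      using 1 2 by (simp add: s_def t_def)
    finally have *: "word_transport \<tau> \<gamma> (concat (replicate (Suc n) [(i, True), (j, True)])) =
        word_transport \<tau> \<gamma> ?w \<circ> (?f (2 * n) \<circ> ?f (2 * n + 1))" .
    have "[0..<2 * Suc n] = [0..<2 * n] @ [2 * n, 2 * n + 1]" by simp
    then show ?case
      unfolding * Suc by (simp only: map_append composite_append list.map composite.simps comp_id)
  qed simp
qed

text \<open>The loop of a relator runs twice around the reflections of a dihedral residue. Each half
  contributes a power of a single involution, and it is the same power both times.\<close>

lemma word_transport_relator:
  fixes \<tau> :: "nat word set \<Rightarrow> 'y \<Rightarrow> 'y"
  assumes ij: "i < k" "j < k" and \<gamma>: "\<gamma> \<in> carrier \<Gamma>" and inv: "\<And>x. \<tau> x \<circ> \<tau> x = id"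
    and res: "\<And>\<gamma> s t. \<lbrakk>\<gamma> \<in> carrier \<Gamma>; s \<in> coxeter_gens k m; t \<in> coxeter_gens k m;
        finite (generate \<Gamma> {s, t})\<rbrakk>
      \<Longrightarrow> \<exists>a. \<forall>x\<in>generate \<Gamma> {s, t}. \<tau> (\<gamma> \<otimes>\<^bsub>\<Gamma>\<^esub> x \<otimes>\<^bsub>\<Gamma>\<^esub> inv\<^bsub>\<Gamma>\<^esub> \<gamma>) \<in> {id, a}"
  shows "word_transport \<tau> \<gamma> (concat (replicate (m i j) [(i, True), (j, True)])) = id"
proof (cases "m i j = 0")
  case False
  define s t where st: "s = cls [(i, True)]" "t = cls [(j, True)]"
  interpret D: involution_pair \<Gamma> s t
    using ij by unfold_locales (auto simp: gen_square st)
  define f where "f l = \<tau> (\<gamma> \<otimes>\<^bsub>\<Gamma>\<^esub> (D.p [^]\<^bsub>\<Gamma>\<^esub> l \<otimes>\<^bsub>\<Gamma>\<^esub> s) \<otimes>\<^bsub>\<Gamma>\<^esub> inv\<^bsub>\<Gamma>\<^esub> \<gamma>)" for l :: nat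
  have per: "D.p [^]\<^bsub>\<Gamma>\<^esub> m i j = \<one>\<^bsub>\<Gamma>\<^esub>"
    using cls_relator[OF ij] cls_power[OF ij] by (simp add: st)
  have "finite (generate \<Gamma> {s, t})"
    using D.finite_generate_pair[OF per] False by simp
  moreover have "s \<in> coxeter_gens k m" "t \<in> coxeter_gens k m"
    using ij by (auto simp: coxeter_gens_def st)
  ultimately obtain a where a: "\<And>x. x \<in> generate \<Gamma> {s, t} \<Longrightarrow> \<tau> (\<gamma> \<otimes>\<^bsub>\<Gamma>\<^esub> x \<otimes>\<^bsub>\<Gamma>\<^esub> inv\<^bsub>\<Gamma>\<^esub> \<gamma>) \<in> {id, a}"
    using res[OF \<gamma>] by metis
  have f: "f l \<in> {id, a}" "f (l + m i j) = f l" "f l \<circ> f l = id" for l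
    using a[OF D.p_pow_s_in] inv D.p_pow_add_period[OF per] by (auto simp: f_def)
  \<comment> \<open>The second half of the loop crosses the same walls as the first half, in the same order.\<close>
  have "map f [0..<2 * m i j] = map f [0..<m i j] @ map f [0..<m i j]"
    by (rule nth_equalityI) (use f(2) in \<open>auto simp: nth_append nth_map\<close>,
      metis add.commute le_add_diff_inverse2 linorder_not_less)
  then have eq: "word_transport \<tau> \<gamma> (concat (replicate (m i j) [(i, True), (j, True)]))
      = composite (map f [0..<m i j]) \<circ> composite (map f [0..<m i j])"
    using word_transport_power[OF ij \<gamma>, of \<tau> "m i j"]
    by (simp add: composite_append f_def[abs_def] st)
  show ?thesis
  proof (cases "\<exists>l. f l \<noteq> id")
    case True
    then have "a \<circ> a = id" using f(1,3) by (metis insertE singletonD)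
    moreover have "set (map f [0..<m i j]) \<subseteq> {id, a}" using f(1) by auto
    ultimately have "composite (map f [0..<m i j]) \<in> {id, a}" by (rule composite_in_pair)
    then show ?thesis using eq \<open>a \<circ> a = id\<close> by auto
  next
    case False
    then have "composite (map f [0..<m i j]) \<in> {id, id}"
      by (intro composite_in_pair) auto
    then show ?thesis using eq by auto
  qed
qed simp

text \<open>Hence the transport descends from words to the presented group.\<close>

lemma word_transport_cong:
  fixes \<tau> :: "nat word set \<Rightarrow> 'y \<Rightarrow> 'y"
  assumes inv: "\<And>x. \<tau> x \<circ> \<tau> x = id"
    and res: "\<And>\<gamma> s t. \<lbrakk>\<gamma> \<in> carrier \<Gamma>; s \<in> coxeter_gens k m; t \<in> coxeter_gens k m;
        finite (generate \<Gamma> {s, t})\<rbrakk>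
      \<Longrightarrow> \<exists>a. \<forall>x\<in>generate \<Gamma> {s, t}. \<tau> (\<gamma> \<otimes>\<^bsub>\<Gamma>\<^esub> x \<otimes>\<^bsub>\<Gamma>\<^esub> inv\<^bsub>\<Gamma>\<^esub> \<gamma>) \<in> {id, a}"
    and "(u, v) \<in> pres_rel {..<k} (coxeter_relators k m)" "\<gamma> \<in> carrier \<Gamma>"
  shows "word_transport \<tau> \<gamma> u = word_transport \<tau> \<gamma> v"
  using assms(3,4)
proof (induction arbitrary: \<gamma> rule: pres_rel.induct)
  case (cancel u v i b)
  let ?x = "\<gamma> \<otimes>\<^bsub>\<Gamma>\<^esub> cls u" and ?s = "cls [(i, True)]"
  have c: "?x \<in> carrier \<Gamma>" "?s \<in> carrier \<Gamma>" "?s \<otimes>\<^bsub>\<Gamma>\<^esub> ?s = \<one>\<^bsub>\<Gamma>\<^esub>"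
    using cancel by (auto simp: gen_square)
  then have "inv\<^bsub>\<Gamma>\<^esub> ?s = ?s" by (intro inv_equality)
  then have "?x \<otimes>\<^bsub>\<Gamma>\<^esub> ?s \<otimes>\<^bsub>\<Gamma>\<^esub> ?s \<otimes>\<^bsub>\<Gamma>\<^esub> inv\<^bsub>\<Gamma>\<^esub> (?x \<otimes>\<^bsub>\<Gamma>\<^esub> ?s) = ?x \<otimes>\<^bsub>\<Gamma>\<^esub> ?s \<otimes>\<^bsub>\<Gamma>\<^esub> inv\<^bsub>\<Gamma>\<^esub> ?x"
    "?x \<otimes>\<^bsub>\<Gamma>\<^esub> ?s \<otimes>\<^bsub>\<Gamma>\<^esub> ?s = ?x"
    using c by (simp_all add: m_assoc inv_mult_group del: cls_carrier)
  then have "word_transport \<tau> ?x ([(i, b), (i, \<not> b)] @ v) = word_transport \<tau> ?x v"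
    using inv by (simp flip: comp_assoc)
  then show ?case using cancel by (simp only: word_transport_append)
next
  case (relator u v r)
  then obtain i j where ij: "i < k" "j < k"
    "r = concat (replicate (m i j) [(i, True), (j, True)])"
    by (auto simp: coxeter_relators_def)
  let ?x = "\<gamma> \<otimes>\<^bsub>\<Gamma>\<^esub> cls u"
  have x: "?x \<in> carrier \<Gamma>" using relator by simp
  have "word_transport \<tau> ?x (r @ v) = word_transport \<tau> ?x v"
    using relator ij x word_transport_relator[OF ij(1,2) x inv res] cls_relator[OF ij(1,2)]
    by (simp add: word_transport_append)
  then show ?case using relator by (simp only: word_transport_append)
qed auto

lemma gallery_group_coxeter: "gallery_group \<Gamma> (coxeter_gens k m)"
proof
  show "finite (coxeter_gens k m)" "coxeter_gens k m \<subseteq> carrier \<Gamma>"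
    by (auto simp: coxeter_gens_def)
  show "s \<otimes>\<^bsub>\<Gamma>\<^esub> s = \<one>\<^bsub>\<Gamma>\<^esub>" if "s \<in> coxeter_gens k m" for s
    using that gen_square by (auto simp: coxeter_gens_def)
  show "generate \<Gamma> (coxeter_gens k m) = carrier \<Gamma>" by (rule generate_coxeter_gens)
next
  fix \<tau> :: "nat word set \<Rightarrow> nat \<Rightarrow> nat"
  assume inv: "\<And>x. \<tau> x \<circ> \<tau> x = id"
    and res: "\<And>\<gamma> s t. \<lbrakk>\<gamma> \<in> carrier \<Gamma>; s \<in> coxeter_gens k m; t \<in> coxeter_gens k m;
        finite (generate \<Gamma> {s, t})\<rbrakk>
      \<Longrightarrow> \<exists>a. \<forall>x\<in>generate \<Gamma> {s, t}. \<tau> (\<gamma> \<otimes>\<^bsub>\<Gamma>\<^esub> x \<otimes>\<^bsub>\<Gamma>\<^esub> inv\<^bsub>\<Gamma>\<^esub> \<gamma>) \<in> {id, a}"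
  define \<Phi> where "\<Phi> X = word_transport \<tau> \<one>\<^bsub>\<Gamma>\<^esub> (SOME u. u \<in> X)" for X
  have \<Phi>: "\<Phi> (cls u) = word_transport \<tau> \<one>\<^bsub>\<Gamma>\<^esub> u" if "u \<in> words {..<k}" for u
  proof -
    have "(SOME v. v \<in> cls u) \<in> cls u"
      by (rule someI[of _ u]) (simp add: that pres_rel.refl)
    then show ?thesis
      unfolding \<Phi>_def using word_transport_cong[OF inv res, of u] by auto
  qed
  have "\<Phi> (\<gamma> \<otimes>\<^bsub>\<Gamma>\<^esub> s) = \<Phi> \<gamma> \<circ> \<tau> (\<gamma> \<otimes>\<^bsub>\<Gamma>\<^esub> s \<otimes>\<^bsub>\<Gamma>\<^esub> inv\<^bsub>\<Gamma>\<^esub> \<gamma>)"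
    if \<gamma>s: "\<gamma> \<in> carrier \<Gamma>" "s \<in> coxeter_gens k m" for \<gamma> s
  proof -
    obtain u where "u \<in> words {..<k}" "\<gamma> = cls u"
      using \<gamma>s(1) unfolding coxeter_group_def carrier_presented_group by blast
    moreover obtain i where "i < k" "s = cls [(i, True)]"
      using \<gamma>s(2) unfolding coxeter_gens_def by blast
    ultimately have u: "u \<in> words {..<k}" "\<gamma> = cls u" "i < k" "s = cls [(i, True)]"
      by simp_all
    then have "\<Phi> (\<gamma> \<otimes>\<^bsub>\<Gamma>\<^esub> s) = word_transport \<tau> \<one>\<^bsub>\<Gamma>\<^esub> (u @ [(i, True)])"
      by (simp add: cls_mult \<Phi>)
    also have "\<dots> = \<Phi> \<gamma> \<circ> \<tau> (\<gamma> \<otimes>\<^bsub>\<Gamma>\<^esub> s \<otimes>\<^bsub>\<Gamma>\<^esub> inv\<^bsub>\<Gamma>\<^esub> \<gamma>)"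
      using u by (simp add: word_transport_append \<Phi>)
    finally show ?thesis .
  qed
  moreover have "\<Phi> \<one>\<^bsub>\<Gamma>\<^esub> = id" using \<Phi>[of "[]"] by (simp add: cls_Nil)
  ultimately show "\<exists>\<Phi>. \<Phi> \<one>\<^bsub>\<Gamma>\<^esub> = id \<and> (\<forall>\<gamma>\<in>carrier \<Gamma>. \<forall>s\<in>coxeter_gens k m.
      \<Phi> (\<gamma> \<otimes>\<^bsub>\<Gamma>\<^esub> s) = \<Phi> \<gamma> \<circ> \<tau> (\<gamma> \<otimes>\<^bsub>\<Gamma>\<^esub> s \<otimes>\<^bsub>\<Gamma>\<^esub> inv\<^bsub>\<Gamma>\<^esub> \<gamma>))"
    by blast
qed

end


section \<open>Sides of a reflection\<close>

context gallery_group
begin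

lemma S_in_carrier [simp, intro]: "s \<in> S \<Longrightarrow> s \<in> carrier G"
  using S_carrier by auto

lemma mult_S_cancel [simp]: "x \<in> carrier G \<Longrightarrow> s \<in> S \<Longrightarrow> x \<otimes> s \<otimes> s = x"
  by (simp add: m_assoc S_square)

lemma generate_subset_carrier: "\<sigma> \<subseteq> S \<Longrightarrow> u \<in> generate G \<sigma> \<Longrightarrow> u \<in> carrier G"
  using generate_in_carrier S_carrier by blast

lemma carrier_induct [consumes 1, case_names one step]:
  assumes "\<gamma> \<in> carrier G" "P \<one>" "\<And>\<gamma> s. \<gamma> \<in> carrier G \<Longrightarrow> s \<in> S \<Longrightarrow> P \<gamma> \<Longrightarrow> P (\<gamma> \<otimes> s)"
  shows "P \<gamma>"
  using assms(1) unfolding generate_S[symmetric]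
  by (induction rule: generate_right_induct)
    (use assms S_carrier S_square generate_S in auto)

lemma conj_eq_iff:
  assumes "\<gamma> \<in> carrier G" "x \<in> carrier G" "r \<in> carrier G"
  shows "\<gamma> \<otimes> x \<otimes> inv \<gamma> = r \<longleftrightarrow> \<gamma> \<otimes> x = r \<otimes> \<gamma>" "inv \<gamma> \<otimes> r \<otimes> \<gamma> = x \<longleftrightarrow> \<gamma> \<otimes> x = r \<otimes> \<gamma>"
proof -
  show "\<gamma> \<otimes> x \<otimes> inv \<gamma> = r \<longleftrightarrow> \<gamma> \<otimes> x = r \<otimes> \<gamma>"
    using assms inv_solve_right' m_closed by metis
  show "inv \<gamma> \<otimes> r \<otimes> \<gamma> = x \<longleftrightarrow> \<gamma> \<otimes> x = r \<otimes> \<gamma>"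
    using assms inv_solve_left' m_closed m_assoc inv_closed by metis
qed

lemma mirror_conj_iff:
  assumes "\<gamma> \<in> carrier G" "s \<in> carrier G" "r \<in> carrier G"
  shows "(r \<otimes> \<gamma>) \<otimes> s \<otimes> inv (r \<otimes> \<gamma>) = r \<longleftrightarrow> \<gamma> \<otimes> s \<otimes> inv \<gamma> = r"
proof -
  have "(r \<otimes> \<gamma>) \<otimes> s = r \<otimes> (r \<otimes> \<gamma>) \<longleftrightarrow> \<gamma> \<otimes> s = r \<otimes> \<gamma>"
    using assms by (simp add: m_assoc)
  then show ?thesis using assms by (simp only: conj_eq_iff m_closed)
qed

lemma reflectionE:
  assumes "r \<in> reflections G S"
  obtains w s where "w \<in> carrier G" "s \<in> S" "r = w \<otimes> s \<otimes> inv w"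
  using assms by (auto simp: reflections_def)

lemma reflectionI: "w \<in> carrier G \<Longrightarrow> s \<in> S \<Longrightarrow> w \<otimes> s \<otimes> inv w \<in> reflections G S"
  by (auto simp: reflections_def)

lemma reflection_carrier [simp, intro]: "r \<in> reflections G S \<Longrightarrow> r \<in> carrier G"
  by (auto simp: reflections_def)

lemma reflection_square: "r \<in> reflections G S \<Longrightarrow> r \<otimes> r = \<one>"
proof (elim reflectionE)
  fix w s assume a: "w \<in> carrier G" "s \<in> S" "r = w \<otimes> s \<otimes> inv w"
  then have "r \<otimes> w = w \<otimes> s" by (simp add: m_assoc)
  then have "r \<otimes> r = w \<otimes> s \<otimes> s \<otimes> inv w" using a by (simp flip: m_assoc)
  then show ?thesis using a by simp
qed

lemma reflection_mult_cancel [simp]: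
  "r \<in> reflections G S \<Longrightarrow> \<gamma> \<in> carrier G \<Longrightarrow> r \<otimes> (r \<otimes> \<gamma>) = \<gamma>"
  by (simp add: reflection_square flip: m_assoc)

text \<open>No finite dihedral residue meets two members of \<open>K\<close>. A coloring of the walls has this
  property for each color class as soon as distinct walls of equal color do not meet.\<close>

definition isolated :: "('a \<Rightarrow> bool) \<Rightarrow> bool" where
  "isolated K \<longleftrightarrow> (\<forall>\<gamma>\<in>carrier G. \<forall>s\<in>S. \<forall>t\<in>S. finite (generate G {s, t}) \<longrightarrow>
    (\<forall>x\<in>generate G {s, t}. \<forall>y\<in>generate G {s, t}.
      K (\<gamma> \<otimes> x \<otimes> inv \<gamma>) \<longrightarrow> K (\<gamma> \<otimes> y \<otimes> inv \<gamma>) \<longrightarrow> x = y))"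

text \<open>The form in which the transport axiom is applied: permutations supported on an isolated
  class.\<close>

lemma isolated_transport:
  assumes K: "isolated K" and \<tau>: "\<And>x. \<tau> x \<circ> \<tau> x = (id :: nat \<Rightarrow> nat)"
    "\<And>x. \<not> K x \<Longrightarrow> \<tau> x = id"
  shows "\<exists>\<Phi>. \<Phi> \<one> = id \<and> (\<forall>\<gamma>\<in>carrier G. inj (\<Phi> \<gamma>)) \<and>
    (\<forall>\<gamma>\<in>carrier G. \<forall>s\<in>S. \<Phi> (\<gamma> \<otimes> s) = \<Phi> \<gamma> \<circ> \<tau> (\<gamma> \<otimes> s \<otimes> inv \<gamma>))"
proof -
  have "\<exists>\<Phi>. \<Phi> \<one> = id \<and> (\<forall>\<gamma>\<in>carrier G. \<forall>s\<in>S. \<Phi> (\<gamma> \<otimes> s) = \<Phi> \<gamma> \<circ> \<tau> (\<gamma> \<otimes> s \<otimes> inv \<gamma>))"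
  proof (rule transport[OF \<tau>(1)])
    fix \<gamma> s t
    assume a: "\<gamma> \<in> carrier G" "s \<in> S" "t \<in> S" "finite (generate G {s, t})"
    show "\<exists>a. \<forall>x\<in>generate G {s, t}. \<tau> (\<gamma> \<otimes> x \<otimes> inv \<gamma>) \<in> {id, a}"
    proof (cases "\<exists>x\<in>generate G {s, t}. K (\<gamma> \<otimes> x \<otimes> inv \<gamma>)")
      case True
      then obtain x where "x \<in> generate G {s, t}" "K (\<gamma> \<otimes> x \<otimes> inv \<gamma>)" by blast
      then have "\<forall>y\<in>generate G {s, t}. \<tau> (\<gamma> \<otimes> y \<otimes> inv \<gamma>) \<in> {id, \<tau> (\<gamma> \<otimes> x \<otimes> inv \<gamma>)}"
        using K a \<tau>(2) unfolding isolated_def by (metis insertCI)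
      then show ?thesis by blast
    qed (use \<tau>(2) in auto)
  qed
  then obtain \<Phi> where \<Phi>: "\<Phi> \<one> = id"
    "\<And>\<gamma> s. \<gamma> \<in> carrier G \<Longrightarrow> s \<in> S \<Longrightarrow> \<Phi> (\<gamma> \<otimes> s) = \<Phi> \<gamma> \<circ> \<tau> (\<gamma> \<otimes> s \<otimes> inv \<gamma>)"
    by blast
  have "inj (\<Phi> \<gamma>)" if "\<gamma> \<in> carrier G" for \<gamma>
    using that
  proof (induction rule: carrier_induct)
    case (step \<gamma> s)
    have "inj (\<tau> x)" for x
      using \<tau>(1)[of x] by (metis inj_on_id inj_on_imageI2)
    then show ?case using step \<Phi>(2) inj_compose by metis
  qed (simp add: \<Phi>)
  then show ?thesis using \<Phi> by blast
qed

text \<open>Letting every member of an isolated class act by the same transposition yields the parity of the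
  number of walls of that class between the base chamber and \<open>\<gamma>\<close>.\<close>

lemma isolated_parity:
  assumes "isolated K"
  shows "\<exists>h :: 'a \<Rightarrow> bool. \<forall>\<gamma>\<in>carrier G. \<forall>s\<in>S. (h (\<gamma> \<otimes> s) \<noteq> h \<gamma>) = K (\<gamma> \<otimes> s \<otimes> inv \<gamma>)"
proof -
  define a where "a = Transposition.transpose 0 (1::nat)"
  have a: "a \<circ> a = id" "a \<noteq> id" by (auto simp: a_def transpose_eq_id_iff)
  define \<tau> where "\<tau> x = (if K x then a else id)" for x
  have \<tau>: "\<tau> x \<circ> \<tau> x = id" "\<not> K x \<Longrightarrow> \<tau> x = id" for x
    using a by (auto simp: \<tau>_def)
  obtain \<Phi> where \<Phi>: "\<Phi> \<one> = id"
    "\<And>\<gamma> s. \<gamma> \<in> carrier G \<Longrightarrow> s \<in> S \<Longrightarrow> \<Phi> (\<gamma> \<otimes> s) = \<Phi> \<gamma> \<circ> \<tau> (\<gamma> \<otimes> s \<otimes> inv \<gamma>)"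
    using isolated_transport[OF assms, of \<tau>] \<tau> by blast
  have \<Phi>_step: "\<Phi> (\<gamma> \<otimes> s) = (if K (\<gamma> \<otimes> s \<otimes> inv \<gamma>) then \<Phi> \<gamma> \<circ> a else \<Phi> \<gamma>)"
    if "\<gamma> \<in> carrier G" "s \<in> S" for \<gamma> s
    by (simp only: \<Phi>(2)[OF that] \<tau>_def comp_id split: if_split) simp
  have range: "\<Phi> \<gamma> = id \<or> \<Phi> \<gamma> = a" if "\<gamma> \<in> carrier G" for \<gamma>
    using that
  proof (induction rule: carrier_induct)
    case (step \<gamma> s)
    then show ?case
      unfolding \<Phi>_step[OF step(1,2)]
      by (elim disjE) (simp_all only: a id_comp split: if_split, blast+)
  qed (simp only: \<Phi> simp_thms)
  have "((\<Phi> (\<gamma> \<otimes> s) = id) \<noteq> (\<Phi> \<gamma> = id)) = K (\<gamma> \<otimes> s \<otimes> inv \<gamma>)"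
    if "\<gamma> \<in> carrier G" "s \<in> S" for \<gamma> s
    using range[OF that(1)] unfolding \<Phi>_step[OF that]
    by (elim disjE) (simp_all only: a id_comp split: if_split, blast+)
  then show ?thesis by (intro exI[of _ "\<lambda>\<gamma>. \<Phi> \<gamma> = id"]) blast
qed

text \<open>For a single wall, this parity is the side on which a chamber lies.\<close>

lemma isolated_singleton: "isolated (\<lambda>x. x = r)"
  unfolding isolated_def
proof (intro ballI impI)
  fix \<gamma> s t x y
  assume "\<gamma> \<in> carrier G" "s \<in> S" "t \<in> S" "x \<in> generate G {s, t}" "y \<in> generate G {s, t}"
    "\<gamma> \<otimes> x \<otimes> inv \<gamma> = r" "\<gamma> \<otimes> y \<otimes> inv \<gamma> = r"
  moreover from this have c: "x \<in> carrier G" "y \<in> carrier G" "r \<in> carrier G"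
    using generate_subset_carrier[of "{s, t}"] by auto
  ultimately have "\<gamma> \<otimes> x = \<gamma> \<otimes> y" by (simp add: conj_eq_iff)
  then show "x = y" using c \<open>\<gamma> \<in> carrier G\<close> by simp
qed

definition side :: "'a \<Rightarrow> 'a \<Rightarrow> bool" where
  "side r = (SOME e. \<forall>\<gamma>\<in>carrier G. \<forall>s\<in>S. (e (\<gamma> \<otimes> s) \<noteq> e \<gamma>) = (\<gamma> \<otimes> s \<otimes> inv \<gamma> = r))"

lemma side_changes_iff:
  "\<gamma> \<in> carrier G \<Longrightarrow> s \<in> S \<Longrightarrow> side r (\<gamma> \<otimes> s) \<noteq> side r \<gamma> \<longleftrightarrow> \<gamma> \<otimes> s \<otimes> inv \<gamma> = r"
  using someI_ex[OF isolated_parity[OF isolated_singleton, of r], folded side_def] by blast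

lemma side_same: "\<gamma> \<in> carrier G \<Longrightarrow> s \<in> S \<Longrightarrow> \<gamma> \<otimes> s \<otimes> inv \<gamma> \<noteq> r \<Longrightarrow> side r (\<gamma> \<otimes> s) = side r \<gamma>"
  using side_changes_iff by blast

lemma S_neq_one: "s \<in> S \<Longrightarrow> s \<noteq> \<one>"
  using side_changes_iff[of \<one> s s] by auto

lemma reflection_neq_one: "r \<in> reflections G S \<Longrightarrow> r \<noteq> \<one>"
  by (auto elim!: reflectionE simp: conj_eq_iff S_neq_one)

text \<open>Chambers that share a vertex off the wall of \<open>r\<close> lie on the same side: a gallery between them
  inside the residue of that vertex crosses only walls through the vertex. This makes sides of
  points well defined.\<close>

lemma side_residue:
  assumes "\<sigma> \<subseteq> S" "u \<in> generate G \<sigma>" "\<gamma> \<in> carrier G" "r \<in> carrier G"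
    "inv \<gamma> \<otimes> r \<otimes> \<gamma> \<notin> generate G \<sigma>"
  shows "side r (\<gamma> \<otimes> u) = side r \<gamma>"
  using assms(2)
proof (induction rule: generate_right_induct)
  case (step u s)
  have s: "s \<in> S" and u: "u \<in> carrier G"
    using step assms(1) generate_subset_carrier by auto
  have "(\<gamma> \<otimes> u) \<otimes> s \<otimes> inv (\<gamma> \<otimes> u) \<noteq> r"
  proof
    assume "(\<gamma> \<otimes> u) \<otimes> s \<otimes> inv (\<gamma> \<otimes> u) = r"
    then have "\<gamma> \<otimes> (u \<otimes> s \<otimes> inv u) \<otimes> inv \<gamma> = r"
      using assms(3) s u by (simp add: inv_mult_group m_assoc)
    then have "inv \<gamma> \<otimes> r \<otimes> \<gamma> = u \<otimes> s \<otimes> inv u"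
      using assms(3,4) s u by (simp only: conj_eq_iff m_closed inv_closed S_in_carrier)
    moreover have "u \<otimes> s \<otimes> inv u \<in> generate G \<sigma>"
      using step generate_m_inv_closed[of \<sigma> u] assms(1) S_carrier
      by (intro generate.eng) (auto intro: generate.incl)
    ultimately show False using assms(5) by simp
  qed
  then have "side r ((\<gamma> \<otimes> u) \<otimes> s) = side r (\<gamma> \<otimes> u)"
    using s u assms(3) by (intro side_same) auto
  then show ?case using step s u assms(3) by (simp add: m_assoc)
qed (use assms S_carrier S_square in auto)

text \<open>A reflection exchanges its two sides: whether it does so at \<open>\<gamma>\<close> does not depend on \<open>\<gamma>\<close>,
  because \<open>\<gamma>\<close> and its mirror image cross simultaneously, and at a chamber adjacent to its wall
  it is clear.\<close>

lemma side_mirror: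
  assumes r: "r \<in> reflections G S" and \<gamma>: "\<gamma> \<in> carrier G"
  shows "side r (r \<otimes> \<gamma>) \<noteq> side r \<gamma>"
proof -
  have const: "(side r (r \<otimes> (x \<otimes> u)) = side r (x \<otimes> u)) = (side r (r \<otimes> x) = side r x)"
    if "u \<in> carrier G" "x \<in> carrier G" for u x
    using that
  proof (induction rule: carrier_induct)
    case (step u s)
    then have "side r (r \<otimes> (x \<otimes> u) \<otimes> s) \<noteq> side r (r \<otimes> (x \<otimes> u))
        \<longleftrightarrow> side r (x \<otimes> u \<otimes> s) \<noteq> side r (x \<otimes> u)"
      using r by (subst (1 2) side_changes_iff) (auto simp: mirror_conj_iff)
    then show ?case using step r by (simp add: m_assoc) blast
  qed (use r in simp)
  obtain w s where w: "w \<in> carrier G" "s \<in> S" "r = w \<otimes> s \<otimes> inv w"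
    using r by (rule reflectionE)
  then have "r \<otimes> w = w \<otimes> s" by (simp add: m_assoc)
  moreover have "side r (w \<otimes> s) \<noteq> side r w" using w side_changes_iff by blast
  ultimately have "side r (r \<otimes> w) \<noteq> side r w" by simp
  then show ?thesis using const[of "inv w \<otimes> \<gamma>" w] w \<gamma> by (simp flip: m_assoc)
qed

text \<open>Chambers on the same side are joined by a gallery that stays on that side. It is obtained from
  an arbitrary gallery by reflecting all of its pieces on the other side. The lemma is phrased
  as an induction principle along such galleries.\<close>

lemma same_side_induct [consumes 4, case_names refl trans step]:
  assumes r: "r \<in> reflections G S" and \<gamma>: "\<gamma> \<in> carrier G" "\<gamma>' \<in> carrier G"
    and same: "side r \<gamma> = side r \<gamma>'"
    and Q_refl: "\<And>x. x \<in> carrier G \<Longrightarrow> Q x x"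
    and Q_trans: "\<And>x y z. Q x y \<Longrightarrow> Q y z \<Longrightarrow> Q x z"
    and Q_step: "\<And>x s. x \<in> carrier G \<Longrightarrow> s \<in> S \<Longrightarrow> x \<otimes> s \<otimes> inv x \<noteq> r \<Longrightarrow> Q x (x \<otimes> s)"
  shows "Q \<gamma> \<gamma>'"
proof -
  define fold where "fold x = (if side r x = side r \<gamma> then x else r \<otimes> x)" for x
  have "Q \<gamma> (fold (\<gamma> \<otimes> u))" if "u \<in> carrier G" for u
    using that
  proof (induction rule: carrier_induct)
    case one
    then show ?case using \<gamma> Q_refl by (simp add: fold_def)
  next
    case (step u s)
    let ?x = "\<gamma> \<otimes> u"
    have x: "?x \<in> carrier G" using step \<gamma> by simp
    have "Q (fold ?x) (fold (?x \<otimes> s))"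
    proof (cases "?x \<otimes> s \<otimes> inv ?x = r")
      case True
      then have "?x \<otimes> s = r \<otimes> ?x" using x step r by (simp add: conj_eq_iff)
      then have "fold (?x \<otimes> s) = fold ?x"
        using side_mirror[OF r x] x r by (auto simp: fold_def)
      moreover have "fold ?x \<in> carrier G" using x r by (auto simp: fold_def)
      ultimately show ?thesis using Q_refl by simp
    next
      case False
      then have "side r (?x \<otimes> s) = side r ?x" using x step side_same by blast
      moreover have "Q ?x (?x \<otimes> s)" using False x step by (intro Q_step)
      moreover have "Q (r \<otimes> ?x) (r \<otimes> ?x \<otimes> s)"
        using False x step r by (intro Q_step) (auto simp: mirror_conj_iff)
      ultimately show ?thesis using x step r by (simp add: fold_def m_assoc)
    qed
    then show ?case using step \<gamma> Q_trans by (simp add: m_assoc)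
  qed
  from this[of "inv \<gamma> \<otimes> \<gamma>'"] show ?thesis
    using \<gamma> same by (simp add: fold_def flip: m_assoc)
qed

text \<open>
  Walls of one color, each disjoint from the others, do not separate two chambers that touch the same
  side of one of these walls. To see this, let crossing the given wall act as \<open>a = (0 1)\<close>
  and crossing any other wall of the color as \<open>b = (1 2)\<close>. A gallery between the two
  chambers on their side of the wall acts as a power \<open>j\<close> of \<open>b\<close>, its mirror image as
  another power \<open>j'\<close>, and comparing the two ways across the wall gives \<open>j \<circ> a = a \<circ> j'\<close>.
  As \<open>a \<circ> b \<circ> a\<close> is not a power of \<open>b\<close>, this forces \<open>j = id\<close>.\<close>

lemma parity_constant_along_wall:
  assumes K: "isolated K"
    and h: "\<And>\<gamma> s. \<gamma> \<in> carrier G \<Longrightarrow> s \<in> S \<Longrightarrow> ((h :: 'a \<Rightarrow> bool) (\<gamma> \<otimes> s) \<noteq> h \<gamma>) = K (\<gamma> \<otimes> s \<otimes> inv \<gamma>)"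
    and r: "r \<in> reflections G S" "K r"
    and \<gamma>: "\<gamma> \<in> carrier G" "s \<in> S" "\<gamma> \<otimes> s \<otimes> inv \<gamma> = r"
    and \<gamma>': "\<gamma>' \<in> carrier G" "s' \<in> S" "\<gamma>' \<otimes> s' \<otimes> inv \<gamma>' = r"
    and same: "side r \<gamma> = side r \<gamma>'"
  shows "h \<gamma> = h \<gamma>'"
proof -
  define a where "a = Transposition.transpose 0 (1::nat)"
  define b where "b = Transposition.transpose 1 (2::nat)"
  have ab: "a \<circ> a = id" "b \<circ> b = id" "b \<noteq> id" by (auto simp: a_def b_def transpose_eq_id_iff)
  define \<tau> where "\<tau> x = (if x = r then a else if K x then b else id)" for x
  have \<tau>: "\<tau> x \<circ> \<tau> x = id" "\<not> K x \<Longrightarrow> \<tau> x = id" for x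
    using ab r(2) by (auto simp: \<tau>_def)
  have "\<exists>\<Phi>. \<Phi> \<one> = id \<and> (\<forall>\<gamma>\<in>carrier G. inj (\<Phi> \<gamma>)) \<and>
    (\<forall>\<gamma>\<in>carrier G. \<forall>s\<in>S. \<Phi> (\<gamma> \<otimes> s) = \<Phi> \<gamma> \<circ> \<tau> (\<gamma> \<otimes> s \<otimes> inv \<gamma>))"
    by (rule isolated_transport[OF K]) (fact \<tau>)+
  then obtain \<Phi> :: "'a \<Rightarrow> nat \<Rightarrow> nat" where \<Phi>: "\<forall>\<gamma>\<in>carrier G. inj (\<Phi> \<gamma>)"
    "\<forall>\<gamma>\<in>carrier G. \<forall>s\<in>S. \<Phi> (\<gamma> \<otimes> s) = \<Phi> \<gamma> \<circ> \<tau> (\<gamma> \<otimes> s \<otimes> inv \<gamma>)"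
    by (elim exE conjE) (rule that)
  note \<Phi> = \<Phi>[rule_format]
  have comp_pair: "f \<circ> g \<in> {id, b}" "f \<circ> g = id \<longleftrightarrow> (f = id \<longleftrightarrow> g = id)"
    if "f \<in> {id, b}" "g \<in> {id, b}" for f g
    using that ab(3) by (elim insertE emptyE; simp only: ab id_comp comp_id; simp)+
  have "\<exists>j\<in>{id, b}. \<exists>j'\<in>{id, b}. \<Phi> \<gamma>' = \<Phi> \<gamma> \<circ> j \<and> \<Phi> (r \<otimes> \<gamma>') = \<Phi> (r \<otimes> \<gamma>) \<circ> j' \<and>
      (h \<gamma>' = h \<gamma> \<longleftrightarrow> j = id)"
    using r(1) \<gamma>(1) \<gamma>'(1) same
  proof (induction rule: same_side_induct)
    case (trans x y z)
    then obtain j1 j1' j2 j2' where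
      1: "j1 \<in> {id, b}" "j1' \<in> {id, b}" "\<Phi> y = \<Phi> x \<circ> j1"
        "\<Phi> (r \<otimes> y) = \<Phi> (r \<otimes> x) \<circ> j1'" "h y = h x \<longleftrightarrow> j1 = id" and
      2: "j2 \<in> {id, b}" "j2' \<in> {id, b}" "\<Phi> z = \<Phi> y \<circ> j2"
        "\<Phi> (r \<otimes> z) = \<Phi> (r \<otimes> y) \<circ> j2'" "h z = h y \<longleftrightarrow> j2 = id"
      by (elim bexE conjE) (rule that)
    have "\<Phi> z = \<Phi> x \<circ> (j1 \<circ> j2)" "\<Phi> (r \<otimes> z) = \<Phi> (r \<otimes> x) \<circ> (j1' \<circ> j2')"
      by (simp_all only: 1(3,4) 2(3,4) comp_assoc)
    moreover have "h z = h x \<longleftrightarrow> j1 \<circ> j2 = id"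
      using comp_pair(2)[OF 1(1) 2(1)] 1(5) 2(5) by blast
    ultimately show ?case
      using comp_pair(1)[OF 1(1) 2(1)] comp_pair(1)[OF 1(2) 2(2)] by blast
  next
    case (step x s)
    have "r \<otimes> x \<otimes> s \<otimes> inv (r \<otimes> x) \<noteq> r" using step r by (simp add: mirror_conj_iff)
    then show ?case
      using step h[of x s] \<Phi>(2)[of x s] \<Phi>(2)[of "r \<otimes> x" s] r ab(3)
      by (auto simp: \<tau>_def m_assoc)
  qed simp
  then obtain j j' where j: "j \<in> {id, b}" "j' \<in> {id, b}" "\<Phi> \<gamma>' = \<Phi> \<gamma> \<circ> j"
    "\<Phi> (r \<otimes> \<gamma>') = \<Phi> (r \<otimes> \<gamma>) \<circ> j'" "h \<gamma>' = h \<gamma> \<longleftrightarrow> j = id" by blast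
  have "r \<otimes> \<gamma> = \<gamma> \<otimes> s" "r \<otimes> \<gamma>' = \<gamma>' \<otimes> s'"
    using \<gamma> \<gamma>' r conj_eq_iff by (metis S_in_carrier reflection_carrier)+
  then have "\<Phi> (r \<otimes> \<gamma>) = \<Phi> \<gamma> \<circ> a" "\<Phi> (r \<otimes> \<gamma>') = \<Phi> \<gamma>' \<circ> a"
    using \<Phi>(2) \<gamma> \<gamma>' by (simp_all add: \<tau>_def)
  then have "\<Phi> \<gamma> \<circ> (j \<circ> a) = \<Phi> \<gamma> \<circ> (a \<circ> j')" using j by (simp add: comp_assoc)
  then have "j \<circ> a = a \<circ> j'" using \<Phi>(1)[OF \<gamma>(1)] by (simp add: fun.inj_map_strong inj_def fun_eq_iff)
  \<comment> \<open>At \<open>0\<close> the two sides give \<open>j 1\<close> and \<open>1\<close>, because \<open>j'\<close> fixes \<open>0\<close>.\<close>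
  then have "j (a 0) = a (j' 0)" by (simp add: fun_eq_iff)
  then have "j = id"
    using j(1,2) by (auto simp: a_def b_def Transposition.transpose_def)
  then show ?thesis using j by simp
qed


section \<open>Points and walls of the Davis complex\<close>

lemma chamber_complex_vertex:
  "\<tau> \<in> chamber_complex G S \<Longrightarrow> \<sigma> \<in> \<tau> \<Longrightarrow> \<sigma> \<subseteq> S"
  by (auto simp: chamber_complex_def cone_def barycentric_subdivision_def nerve_def)

lemma supp_subset_S: "x \<in> model_chamber G S \<Longrightarrow> \<sigma> \<in> supp x \<Longrightarrow> \<sigma> \<subseteq> S"
  using chamber_complex_vertex[of "supp x"] by (auto simp: model_chamber_def realization_def)

lemma subgroup_generate: "\<sigma> \<subseteq> S \<Longrightarrow> subgroup (generate G \<sigma>) G"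
  using generate_is_subgroup S_carrier by blast

lemma generate_quotient_sym:
  assumes "\<sigma> \<subseteq> S" "a \<in> carrier G" "b \<in> carrier G" "inv a \<otimes> b \<in> generate G \<sigma>"
  shows "inv b \<otimes> a \<in> generate G \<sigma>"
  using subgroup.m_inv_closed[OF subgroup_generate[OF assms(1)] assms(4)] assms
  by (simp add: inv_mult_group)

lemma generate_quotient_trans:
  assumes "\<sigma> \<subseteq> S" "a \<in> carrier G" "b \<in> carrier G" "c \<in> carrier G"
    "inv a \<otimes> b \<in> generate G \<sigma>" "inv b \<otimes> c \<in> generate G \<sigma>"
  shows "inv a \<otimes> c \<in> generate G \<sigma>"
proof -
  have "(inv a \<otimes> b) \<otimes> (inv b \<otimes> c) \<in> generate G \<sigma>" by (rule generate.eng[OF assms(5,6)])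
  then show ?thesis using assms by (metis inv_closed m_assoc m_closed r_inv r_one)
qed

lemma equiv_davis_rel: "equiv (carrier G \<times> model_chamber G S) (davis_rel G S)"
proof (rule equivI)
  show "davis_rel G S \<subseteq> (carrier G \<times> model_chamber G S) \<times> (carrier G \<times> model_chamber G S)"
    by (auto simp: davis_rel_def)
  show "refl_on (carrier G \<times> model_chamber G S) (davis_rel G S)"
    by (rule refl_onI) (auto simp: davis_rel_def generate.one)
  show "sym (davis_rel G S)"
    by (rule symI) (auto simp: davis_rel_def, meson supp_subset_S generate_quotient_sym)
  show "trans (davis_rel G S)"
    by (rule transI) (auto simp: davis_rel_def, meson supp_subset_S generate_quotient_trans)
qed

lemma davis_proj_eq_iff:
  assumes "a \<in> carrier G" "b \<in> carrier G" "x \<in> model_chamber G S" "y \<in> model_chamber G S"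
  shows "davis_proj G S (a, x) = davis_proj G S (b, y) \<longleftrightarrow>
    x = y \<and> (\<forall>\<sigma>\<in>supp x. inv a \<otimes> b \<in> generate G \<sigma>)"
  unfolding davis_proj_def using assms
  by (subst eq_equiv_class_iff[OF equiv_davis_rel]) (auto simp: davis_rel_def)

lemma davis_proj_in_complex:
  "a \<in> carrier G \<Longrightarrow> x \<in> model_chamber G S \<Longrightarrow> davis_proj G S (a, x) \<in> davis_complex G S"
  by (auto simp: davis_proj_def davis_complex_def quotient_def)

lemma davis_complexE:
  assumes "P \<in> davis_complex G S"
  obtains a x where "a \<in> carrier G" "x \<in> model_chamber G S" "P = davis_proj G S (a, x)"
  using assms by (auto simp: davis_proj_def davis_complex_def quotient_def)

lemma davis_act_proj:
  assumes r: "r \<in> carrier G" and a: "a \<in> carrier G" and x: "x \<in> model_chamber G S"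
  shows "davis_act G r (davis_proj G S (a, x)) = davis_proj G S (r \<otimes> a, x)"
proof -
  have rel: "inv (r \<otimes> a) \<otimes> (r \<otimes> b) = inv a \<otimes> b" if "b \<in> carrier G" for b
    using r a that by (simp add: inv_mult_group m_assoc inv_solve_left')
  have "(r \<otimes> a, x) \<in> carrier G \<times> model_chamber G S" using r a x by simp
  show ?thesis
  proof (intro equalityI subsetI)
    fix q assume "q \<in> davis_act G r (davis_proj G S (a, x))"
    then show "q \<in> davis_proj G S (r \<otimes> a, x)"
      using r a rel by (auto simp: davis_act_def davis_proj_def davis_rel_def)
  next
    fix q assume "q \<in> davis_proj G S (r \<otimes> a, x)"
    then obtain b where b: "q = (b, x)" "b \<in> carrier G"
      "\<forall>\<sigma>\<in>supp x. inv (r \<otimes> a) \<otimes> b \<in> generate G \<sigma>"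
      by (auto simp: davis_proj_def davis_rel_def)
    have eq: "r \<otimes> (inv r \<otimes> b) = b" using b r by (simp flip: m_assoc)
    then have "(inv r \<otimes> b, x) \<in> davis_proj G S (a, x)"
      using b r a x rel[of "inv r \<otimes> b"] by (auto simp: davis_proj_def davis_rel_def)
    then show "q \<in> davis_act G r (davis_proj G S (a, x))"
      unfolding davis_act_def using b eq by (force intro: image_eqI[of _ _ "(inv r \<otimes> b, x)"])
  qed
qed

lemma proj_in_wall_iff:
  assumes "r \<in> carrier G" "a \<in> carrier G" "x \<in> model_chamber G S"
  shows "davis_proj G S (a, x) \<in> wall G S r \<longleftrightarrow> (\<forall>\<sigma>\<in>supp x. inv a \<otimes> r \<otimes> a \<in> generate G \<sigma>)"
proof -
  have "davis_proj G S (a, x) \<in> wall G S r \<longleftrightarrow> davis_proj G S (a, x) = davis_proj G S (r \<otimes> a, x)"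
    using assms by (auto simp: wall_def davis_act_proj davis_proj_in_complex)
  then show ?thesis using assms by (simp add: davis_proj_eq_iff m_assoc)
qed

definition vertex :: "'a set \<Rightarrow> 'a set \<Rightarrow> real" where
  "vertex \<sigma> = (\<lambda>\<tau>. if \<tau> = \<sigma> then 1 else 0)"

lemma supp_vertex [simp]: "supp (vertex \<sigma>) = {\<sigma>}"
  by (auto simp: supp_def vertex_def)

lemma vertex_in_model_chamber: "\<sigma> = {} \<or> \<sigma> \<in> nerve G S \<Longrightarrow> vertex \<sigma> \<in> model_chamber G S"
  by (auto simp: model_chamber_def realization_def chamber_complex_def cone_def
      barycentric_subdivision_def chain_subset_def vertex_def[abs_def] supp_def)

abbreviation center :: "'a set \<Rightarrow> real" where "center \<equiv> vertex {}"

lemma center_in_model_chamber [simp]: "center \<in> model_chamber G S"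
  by (simp add: vertex_in_model_chamber)

lemma generate_singleton: "s \<in> S \<Longrightarrow> generate G {s} = {\<one>, s}"
proof (intro equalityI subsetI)
  fix u assume s: "s \<in> S" and "u \<in> generate G {s}"
  from this(2) show "u \<in> {\<one>, s}"
    by (induction rule: generate_right_induct) (use s S_square in auto)
qed (auto intro: generate.intros)

lemma facet_vertex_in_model_chamber [simp]: "s \<in> S \<Longrightarrow> vertex {s} \<in> model_chamber G S"
  by (rule vertex_in_model_chamber) (auto simp: nerve_def generate_singleton)

text \<open>The barycenter of a face lies in the wall of that face and in no other. Hence walls determine
  their reflections, and neighboring chambers on the same side are connected off the wall.\<close>

lemma facet_vertex_in_wall_iff:
  assumes "r \<in> reflections G S" "a \<in> carrier G" "s \<in> S"
  shows "davis_proj G S (a, vertex {s}) \<in> wall G S r \<longleftrightarrow> a \<otimes> s \<otimes> inv a = r"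
proof -
  have "inv a \<otimes> r \<otimes> a \<noteq> \<one>"
    using assms reflection_neq_one by (subst conj_eq_iff) auto
  then show ?thesis
    using assms by (simp add: proj_in_wall_iff generate_singleton conj_eq_iff)
qed

lemma wall_inj:
  assumes r: "r \<in> reflections G S" "r' \<in> reflections G S" and eq: "wall G S r = wall G S r'"
  shows "r = r'"
proof -
  obtain w s where w: "w \<in> carrier G" "s \<in> S" "r = w \<otimes> s \<otimes> inv w"
    using r(1) by (rule reflectionE)
  then have "davis_proj G S (w, vertex {s}) \<in> wall G S r"
    using r by (simp add: facet_vertex_in_wall_iff)
  then show ?thesis using eq r w by (simp add: facet_vertex_in_wall_iff)
qed

text \<open>Two reflections in a finite dihedral residue fix the vertex of that residue.\<close>

lemma residue_walls_meet:
  assumes "\<gamma> \<in> carrier G" "s \<in> S" "t \<in> S" "finite (generate G {s, t})"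
    "x \<in> generate G {s, t}" "y \<in> generate G {s, t}"
  shows "wall G S (\<gamma> \<otimes> x \<otimes> inv \<gamma>) \<inter> wall G S (\<gamma> \<otimes> y \<otimes> inv \<gamma>) \<noteq> {}"
proof -
  have c: "x \<in> carrier G" "y \<in> carrier G" using assms generate_subset_carrier[of "{s, t}"] by auto
  have v: "vertex {s, t} \<in> model_chamber G S"
    using assms by (intro vertex_in_model_chamber) (auto simp: nerve_def)
  have "inv \<gamma> \<otimes> (\<gamma> \<otimes> z \<otimes> inv \<gamma>) \<otimes> \<gamma> = z" if "z \<in> carrier G" for z
    using that assms(1) by (subst conj_eq_iff) (auto simp: m_assoc)
  then have "davis_proj G S (\<gamma>, vertex {s, t}) \<in> wall G S (\<gamma> \<otimes> z \<otimes> inv \<gamma>)"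
    if "z \<in> generate G {s, t}" "z \<in> carrier G" for z
    using that assms(1) v by (subst proj_in_wall_iff) auto
  then show ?thesis using assms c by blast
qed


section \<open>Halfspaces are the components of the complement of a wall\<close>

lemma topspace_davis_topology: "topspace (davis_topology G S) = davis_complex G S"
proof -
  have "openin (davis_topology G S) (davis_complex G S)"
    unfolding openin_davis_topology
  proof
    have "{p \<in> topspace (davis_cover G S). davis_proj G S p \<in> davis_complex G S}
        = topspace (davis_cover G S)"
      by (auto simp: davis_cover_def davis_proj_in_complex)
    then show "openin (davis_cover G S)
        {p \<in> topspace (davis_cover G S). davis_proj G S p \<in> davis_complex G S}" by simp
  qed simp
  then show ?thesis
    by (metis openin_davis_topology openin_subset openin_topspace subset_antisym)
qed

lemma continuous_map_davis_proj:
  "continuous_map (davis_cover G S) (davis_topology G S) (davis_proj G S)"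
  by (auto simp: continuous_map_def topspace_davis_topology openin_davis_topology
      davis_cover_def davis_proj_in_complex)

definition segment_to_center :: "('a set \<Rightarrow> real) \<Rightarrow> real \<Rightarrow> 'a set \<Rightarrow> real" where
  "segment_to_center x t = (\<lambda>\<sigma>. (1 - t) * x \<sigma> + t * center \<sigma>)"

lemma segment_ends [simp]: "segment_to_center x 0 = x" "segment_to_center x 1 = center"
  by (auto simp: segment_to_center_def)

lemma model_chamber_nonneg: "x \<in> model_chamber G S \<Longrightarrow> 0 \<le> x \<sigma>"
  by (simp add: model_chamber_def realization_def)

lemma empty_in_supp_segment:
  assumes "x \<in> model_chamber G S" "0 < t" "t \<le> 1"
  shows "{} \<in> supp (segment_to_center x t)"
proof -
  have "0 \<le> (1 - t) * x {}" using assms model_chamber_nonneg by simp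
  then show ?thesis using assms by (simp add: supp_def segment_to_center_def vertex_def)
qed

lemma segment_in_model_chamber:
  assumes x: "x \<in> model_chamber G S" and t: "0 \<le> t" "t \<le> 1"
  shows "segment_to_center x t \<in> model_chamber G S"
proof (cases "t = 0 \<or> t = 1")
  case False
  then have t': "0 < t" "t < 1" using t by auto
  let ?y = "segment_to_center x t"
  have nonneg: "0 \<le> x \<sigma>" for \<sigma> using x model_chamber_nonneg by simp
  have sum: "sum x (supp x) = 1" and K: "supp x \<in> chamber_complex G S"
    using x by (auto simp: model_chamber_def realization_def)
  have fin: "finite (supp x)" using sum sum.infinite by fastforce
  \<comment> \<open>Strictly between the ends, the support is that of \<open>x\<close> joined with the cone point.\<close>
  have supp: "supp ?y = insert {} (supp x)"
  proof (intro equalityI subsetI)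
    fix \<sigma> assume "\<sigma> \<in> insert {} (supp x)"
    then consider "\<sigma> = {}" | "\<sigma> \<noteq> {}" "x \<sigma> \<noteq> 0" by (auto simp: supp_def)
    then show "\<sigma> \<in> supp ?y"
      using empty_in_supp_segment[OF x t'(1)] t' t(2)
      by cases (auto simp: supp_def segment_to_center_def vertex_def)
  qed (auto simp: supp_def segment_to_center_def vertex_def split: if_splits)
  have "sum ?y (supp ?y) = (1 - t) * sum x (insert {} (supp x)) + t * sum center (insert {} (supp x))"
    by (simp only: supp) (simp only: segment_to_center_def sum.distrib sum_distrib_left)
  also have "sum x (insert {} (supp x)) = sum x (supp x)"
    using fin by (intro sum.mono_neutral_right) (auto simp: supp_def)
  also have "sum center (insert {} (supp x)) = sum center {{}}"
    using fin by (intro sum.mono_neutral_right) (auto simp: vertex_def)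
  finally have "sum ?y (supp ?y) = 1" using sum by (simp add: vertex_def)
  moreover have "supp ?y \<in> chamber_complex G S"
    using K unfolding supp chamber_complex_def cone_def by auto
  moreover have "0 \<le> ?y \<sigma>" for \<sigma>
    using nonneg t by (simp add: segment_to_center_def vertex_def)
  ultimately show ?thesis by (simp add: model_chamber_def realization_def)
qed (use x in auto)

lemma continuous_segment:
  assumes "\<gamma> \<in> carrier G" "x \<in> model_chamber G S"
  shows "continuous_map (top_of_set {0..1}) (davis_topology G S)
    (\<lambda>t. davis_proj G S (\<gamma>, segment_to_center x t))"
proof -
  have "continuous_on {0..1} (segment_to_center x)"
    unfolding segment_to_center_def
    by (intro continuous_on_coordinatewise_then_product continuous_intros)
  then have "continuous_map (top_of_set {0..1}) (top_of_set (model_chamber G S)) (segment_to_center x)"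
    using segment_in_model_chamber[OF assms(2)] by (auto simp: continuous_map_in_subtopology)
  then have "continuous_map (top_of_set {0..1}) (davis_cover G S) (\<lambda>t. (\<gamma>, segment_to_center x t))"
    unfolding davis_cover_def using assms(1) by (intro continuous_map_pairedI) auto
  from continuous_map_compose[OF this continuous_map_davis_proj] show ?thesis
    by (simp add: o_def)
qed

text \<open>A point with positive coordinate at the cone point has trivial stabilizer.\<close>

lemma segment_not_in_wall:
  assumes "r \<in> reflections G S" "\<gamma> \<in> carrier G" "x \<in> model_chamber G S" "0 < t" "t \<le> 1"
  shows "davis_proj G S (\<gamma>, segment_to_center x t) \<notin> wall G S r"
proof -
  have "inv \<gamma> \<otimes> r \<otimes> \<gamma> \<noteq> \<one>"
    using assms reflection_neq_one by (subst conj_eq_iff) auto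
  then have "inv \<gamma> \<otimes> r \<otimes> \<gamma> \<notin> generate G {}" by (simp add: generate_empty)
  then show ?thesis
    using assms empty_in_supp_segment[OF assms(3-5)] segment_in_model_chamber[OF assms(3)]
    by (subst proj_in_wall_iff) auto
qed

lemma center_not_in_wall:
  "r \<in> reflections G S \<Longrightarrow> \<gamma> \<in> carrier G \<Longrightarrow> davis_proj G S (\<gamma>, center) \<notin> wall G S r"
  using segment_not_in_wall[of r \<gamma> center 1] by simp

definition halfspace :: "'a \<Rightarrow> 'a \<Rightarrow> 'a davis_point set" where
  "halfspace r p = {davis_proj G S (\<gamma>, x) | \<gamma> x.
     \<gamma> \<in> carrier G \<and> x \<in> model_chamber G S \<and> side r \<gamma> = side r p} - wall G S r"

lemma proj_in_halfspace_iff: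
  assumes r: "r \<in> reflections G S" and \<gamma>: "\<gamma> \<in> carrier G" and x: "x \<in> model_chamber G S"
  shows "davis_proj G S (\<gamma>, x) \<in> halfspace r p \<longleftrightarrow>
    side r \<gamma> = side r p \<and> davis_proj G S (\<gamma>, x) \<notin> wall G S r"
proof -
  have "side r \<gamma>' = side r \<gamma>"
    if eq: "davis_proj G S (\<gamma>, x) = davis_proj G S (\<gamma>', y)" and \<gamma>': "\<gamma>' \<in> carrier G"
      and y: "y \<in> model_chamber G S" and nw: "davis_proj G S (\<gamma>, x) \<notin> wall G S r" for \<gamma>' y
  proof -
    obtain \<sigma> where \<sigma>: "\<sigma> \<in> supp x" "inv \<gamma> \<otimes> r \<otimes> \<gamma> \<notin> generate G \<sigma>"
      using nw r \<gamma> x by (auto simp: proj_in_wall_iff)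
    have "inv \<gamma> \<otimes> \<gamma>' \<in> generate G \<sigma>"
      using eq \<sigma>(1) \<gamma> \<gamma>' x y by (simp add: davis_proj_eq_iff)
    then have "side r (\<gamma> \<otimes> (inv \<gamma> \<otimes> \<gamma>')) = side r \<gamma>"
      using \<sigma> supp_subset_S[OF x] \<gamma> r by (intro side_residue) auto
    then show ?thesis using \<gamma> \<gamma>' by (simp flip: m_assoc)
  qed
  then show ?thesis unfolding halfspace_def using \<gamma> x by auto
qed

lemma halfspace_cong: "side r p = side r q \<Longrightarrow> halfspace r p = halfspace r q"
  by (simp add: halfspace_def)

lemma halfspace_subset: "halfspace r p \<subseteq> davis_complex G S - wall G S r"
  by (auto simp: halfspace_def davis_proj_in_complex)

lemma openin_halfspace:
  assumes r: "r \<in> reflections G S"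
  shows "openin (davis_topology G S) (halfspace r p)"
  unfolding openin_davis_topology
proof
  show "halfspace r p \<subseteq> davis_complex G S" using halfspace_subset by blast
  define I where "I = {(\<gamma>, \<sigma>). \<gamma> \<in> carrier G \<and> side r \<gamma> = side r p \<and> inv \<gamma> \<otimes> r \<otimes> \<gamma> \<notin> generate G \<sigma>}"
  have "{q \<in> topspace (davis_cover G S). davis_proj G S q \<in> halfspace r p}
      = (\<Union>(\<gamma>, \<sigma>)\<in>I. {\<gamma>} \<times> (model_chamber G S \<inter> {x. x \<sigma> \<noteq> 0}))"
    using r by (auto simp: davis_cover_def proj_in_halfspace_iff proj_in_wall_iff I_def supp_def)
      blast+
  moreover have "openin (davis_cover G S) ({\<gamma>} \<times> (model_chamber G S \<inter> {x. x \<sigma> \<noteq> 0}))"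
    if "\<gamma> \<in> carrier G" for \<gamma> and \<sigma> :: "'a set"
  proof -
    have "open {x :: 'a set \<Rightarrow> real. x \<sigma> \<noteq> 0}"
      by (intro open_Collect_neq continuous_on_const) simp
    then show ?thesis
      using that by (simp add: davis_cover_def openin_prod_Times_iff openin_open_Int)
  qed
  ultimately show "openin (davis_cover G S)
      {q \<in> topspace (davis_cover G S). davis_proj G S q \<in> halfspace r p}"
    by (auto simp: I_def intro!: openin_Union)
qed

abbreviation off_wall :: "'a \<Rightarrow> 'a davis_point topology" where
  "off_wall r \<equiv> subtopology (davis_topology G S) (davis_complex G S - wall G S r)"

lemma topspace_off_wall: "topspace (off_wall r) = davis_complex G S - wall G S r"
  by (auto simp: topspace_davis_topology)

lemma connected_to_center:
  assumes r: "r \<in> reflections G S" and \<gamma>: "\<gamma> \<in> carrier G" and x: "x \<in> model_chamber G S"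
    and nw: "davis_proj G S (\<gamma>, x) \<notin> wall G S r"
  shows "connected_component_of (off_wall r) (davis_proj G S (\<gamma>, x)) (davis_proj G S (\<gamma>, center))"
proof -
  let ?f = "\<lambda>t. davis_proj G S (\<gamma>, segment_to_center x t)"
  have "connectedin (davis_topology G S) (?f ` {0..1})"
    by (rule connectedin_continuous_map_image[OF continuous_segment[OF \<gamma> x]]) simp
  moreover have "?f t \<in> davis_complex G S - wall G S r" if "t \<in> {0..1}" for t
    using that nw segment_not_in_wall[OF r \<gamma> x, of t] segment_in_model_chamber[OF x, of t] \<gamma>
      davis_proj_in_complex by (cases "t = 0") auto
  ultimately have "connectedin (off_wall r) (?f ` {0..1})"
    by (auto simp: connectedin_subtopology)
  moreover have "davis_proj G S (\<gamma>, x) \<in> ?f ` {0..1}" "davis_proj G S (\<gamma>, center) \<in> ?f ` {0..1}"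
    by (rule image_eqI[of _ _ 0]; simp) (rule image_eqI[of _ _ 1]; simp)
  ultimately show ?thesis unfolding connected_component_of_def by blast
qed

lemma same_side_connected:
  assumes r: "r \<in> reflections G S" and \<gamma>: "\<gamma> \<in> carrier G" "\<gamma>' \<in> carrier G"
    and "side r \<gamma> = side r \<gamma>'"
  shows "connected_component_of (off_wall r) (davis_proj G S (\<gamma>, center)) (davis_proj G S (\<gamma>', center))"
  using assms
proof (induction rule: same_side_induct)
  case (refl x)
  then show ?case
    using center_not_in_wall[OF r] davis_proj_in_complex
    by (simp add: connected_component_of_refl topspace_davis_topology)
next
  case (trans x y z)
  then show ?case by (rule connected_component_of_trans)
next
  case (step x s)
  let ?v = "vertex {s}"
  have nw: "davis_proj G S (x, ?v) \<notin> wall G S r"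
    using step r by (simp add: facet_vertex_in_wall_iff)
  have "inv x \<otimes> (x \<otimes> s) = s" using step by (simp flip: m_assoc)
  then have eq: "davis_proj G S (x, ?v) = davis_proj G S (x \<otimes> s, ?v)"
    using step by (simp add: davis_proj_eq_iff generate_singleton)
  have "connected_component_of (off_wall r) (davis_proj G S (x, ?v)) (davis_proj G S (x, center))"
    using connected_to_center[OF r _ _ nw] step by simp
  moreover have "connected_component_of (off_wall r) (davis_proj G S (x, ?v))
      (davis_proj G S (x \<otimes> s, center))"
    using connected_to_center[OF r, of "x \<otimes> s" ?v] nw step eq by simp
  ultimately show ?case
    by (meson connected_component_of_sym connected_component_of_trans)
qed

text \<open>Halfspaces are connected by the preceding lemmas, and they are open and closed because
  the complement of one is the other.\<close>

lemma connected_component_eq_halfspace: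
  assumes r: "r \<in> reflections G S" and \<gamma>: "\<gamma> \<in> carrier G" and x: "x \<in> model_chamber G S"
    and nw: "davis_proj G S (\<gamma>, x) \<notin> wall G S r"
  shows "connected_component_of_set (off_wall r) (davis_proj G S (\<gamma>, x)) = halfspace r \<gamma>"
proof
  show "halfspace r \<gamma> \<subseteq> connected_component_of_set (off_wall r) (davis_proj G S (\<gamma>, x))"
  proof
    fix Q assume "Q \<in> halfspace r \<gamma>"
    then obtain \<gamma>' y where Q: "Q = davis_proj G S (\<gamma>', y)" "\<gamma>' \<in> carrier G"
      "y \<in> model_chamber G S" "side r \<gamma> = side r \<gamma>'" "Q \<notin> wall G S r"
      by (auto simp: halfspace_def)
    have "connected_component_of (off_wall r) (davis_proj G S (\<gamma>', center)) Q"
      using connected_to_center[OF r Q(2,3)] Q(1,5) by (simp add: connected_component_of_sym)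
    note connected_component_of_trans[OF same_side_connected[OF r \<gamma> Q(2,4)] this]
    note connected_component_of_trans[OF connected_to_center[OF r \<gamma> x nw] this]
    then show "Q \<in> connected_component_of_set (off_wall r) (davis_proj G S (\<gamma>, x))" by simp
  qed
next
  let ?C = "connected_component_of_set (off_wall r) (davis_proj G S (\<gamma>, x))"
  have open_half: "openin (off_wall r) (halfspace r q)" for q
    using openin_halfspace[OF r, of q] halfspace_subset[of r q]
    by (auto simp: openin_subtopology intro!: exI[of _ "halfspace r q"])
  have "topspace (off_wall r) - halfspace r \<gamma> = halfspace r (r \<otimes> \<gamma>)"
  proof (intro equalityI subsetI)
    fix P assume "P \<in> topspace (off_wall r) - halfspace r \<gamma>"
    then show "P \<in> halfspace r (r \<otimes> \<gamma>)"
      using r side_mirror[OF r \<gamma>]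
      by (auto simp: topspace_davis_topology proj_in_halfspace_iff elim!: davis_complexE)
  next
    fix P assume P: "P \<in> halfspace r (r \<otimes> \<gamma>)"
    then have "P \<in> topspace (off_wall r)" using halfspace_subset topspace_off_wall by blast
    moreover have "P \<notin> halfspace r \<gamma>"
      using P r side_mirror[OF r \<gamma>] unfolding halfspace_def[of r "r \<otimes> \<gamma>"]
      by (auto simp: proj_in_halfspace_iff)
    ultimately show "P \<in> topspace (off_wall r) - halfspace r \<gamma>" by blast
  qed
  then have "closedin (off_wall r) (halfspace r \<gamma>)"
    using open_half[of "r \<otimes> \<gamma>"] halfspace_subset[of r \<gamma>]
    unfolding closedin_def topspace_off_wall by simp
  then have "?C \<subseteq> halfspace r \<gamma> \<or> disjnt ?C (halfspace r \<gamma>)"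
    by (rule connectedin_clopen_cases[OF connectedin_connected_component_of _ open_half])
  moreover have "davis_proj G S (\<gamma>, x) \<in> halfspace r \<gamma>"
    using assms by (simp add: proj_in_halfspace_iff)
  moreover have "davis_proj G S (\<gamma>, x) \<in> ?C"
    using nw \<gamma> x davis_proj_in_complex
    by (simp add: connected_component_of_refl topspace_davis_topology)
  ultimately show "?C \<subseteq> halfspace r \<gamma>" by (auto simp: disjnt_iff)
qed

lemma connected_components_off_wall:
  assumes r: "r \<in> reflections G S" and p: "p \<in> carrier G"
  shows "connected_components_of (off_wall r) = {halfspace r p, halfspace r (r \<otimes> p)}"
proof (intro equalityI subsetI)
  fix C assume "C \<in> connected_components_of (off_wall r)"
  then obtain P where P: "P \<in> davis_complex G S" "P \<notin> wall G S r"
    "C = connected_component_of_set (off_wall r) P"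
    unfolding connected_components_of_def topspace_off_wall by auto
  then obtain \<gamma> x where \<gamma>: "\<gamma> \<in> carrier G" "x \<in> model_chamber G S" "P = davis_proj G S (\<gamma>, x)"
    by (auto elim: davis_complexE)
  then have "C = halfspace r \<gamma>" using P r connected_component_eq_halfspace by simp
  moreover have "side r \<gamma> = side r p \<or> side r \<gamma> = side r (r \<otimes> p)"
    using side_mirror[OF r p] by blast
  ultimately show "C \<in> {halfspace r p, halfspace r (r \<otimes> p)}"
    using halfspace_cong by blast
next
  have "halfspace r q \<in> connected_components_of (off_wall r)" if q: "q \<in> carrier G" for q
  proof -
    have nw: "davis_proj G S (q, center) \<notin> wall G S r" using center_not_in_wall r q by blast
    then have "davis_proj G S (q, center) \<in> topspace (off_wall r)"
      unfolding topspace_off_wall using q davis_proj_in_complex by simp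
    then show ?thesis
      unfolding connected_components_of_def
      using connected_component_eq_halfspace[OF r q center_in_model_chamber nw]
      by (intro image_eqI[of _ _ "davis_proj G S (q, center)"]) auto
  qed
  moreover fix C assume "C \<in> {halfspace r p, halfspace r (r \<otimes> p)}"
  ultimately show "C \<in> connected_components_of (off_wall r)" using r p by auto
qed

lemma halfspace_mirror_neq:
  assumes r: "r \<in> reflections G S" and p: "p \<in> carrier G"
  shows "halfspace r p \<noteq> halfspace r (r \<otimes> p)"
proof -
  have "davis_proj G S (p, center) \<in> halfspace r p"
    "davis_proj G S (p, center) \<notin> halfspace r (r \<otimes> p)"
    using r p side_mirror[OF r p] center_not_in_wall[OF r p]
    by (simp_all add: proj_in_halfspace_iff)
  then show ?thesis by blast
qed

text \<open>A point on the face of type \<open>s\<close> is not interior to the chamber, because the segment from it to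
  the center of the adjacent chamber leaves the chamber at once.\<close>

lemma interior_chamber_subset_halfspace:
  assumes \<gamma>: "\<gamma> \<in> carrier G" and s: "s \<in> S" and r: "r = \<gamma> \<otimes> s \<otimes> inv \<gamma>"
  shows "davis_topology G S interior_of chamber G S \<gamma> \<subseteq> halfspace r \<gamma>"
proof
  fix P assume "P \<in> davis_topology G S interior_of chamber G S \<gamma>"
  then obtain U where U: "openin (davis_topology G S) U" "P \<in> U" "U \<subseteq> chamber G S \<gamma>"
    by (auto simp: interior_of_def)
  then obtain x where x: "x \<in> model_chamber G S" "P = davis_proj G S (\<gamma>, x)"
    by (auto simp: chamber_def)
  have refl: "r \<in> reflections G S" using \<gamma> s r reflectionI by simp
  have conj: "inv \<gamma> \<otimes> r \<otimes> \<gamma> = s"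
    using conj_eq_iff[OF \<gamma> S_in_carrier[OF s] reflection_carrier[OF refl]] r by simp
  have adj: "inv \<gamma> \<otimes> (\<gamma> \<otimes> s) = s" using \<gamma> s by (simp flip: m_assoc)
  have "P \<notin> wall G S r"
  proof
    assume "P \<in> wall G S r"
    then have "\<forall>\<sigma>\<in>supp x. s \<in> generate G \<sigma>"
      using proj_in_wall_iff[of r \<gamma> x] refl \<gamma> x conj by simp
    then have P: "P = davis_proj G S (\<gamma> \<otimes> s, x)"
      using x \<gamma> s adj by (simp add: davis_proj_eq_iff)
    let ?f = "\<lambda>t. davis_proj G S (\<gamma> \<otimes> s, segment_to_center x t)"
    have "continuous_map (top_of_set {0..1}) (davis_topology G S) ?f"
      using \<gamma> s x by (intro continuous_segment) auto
    then have "openin (top_of_set {0..1}) {t \<in> {0..1}. ?f t \<in> U}"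
      using U(1) by (auto simp: continuous_map_def)
    moreover have "0 \<in> {t \<in> {0..1}. ?f t \<in> U}" using U(2) P by simp
    ultimately obtain e where e: "e > 0" "\<And>t. t \<in> {0..1} \<Longrightarrow> dist t 0 < e \<Longrightarrow> ?f t \<in> U"
      unfolding openin_euclidean_subtopology_iff by blast
    define t where "t = min 1 (e / 2)"
    have t: "0 < t" "t \<le> 1" "t < e" using e(1) by (auto simp: t_def)
    then have "?f t \<in> chamber G S \<gamma>" using e(2)[of t] U(3) by auto
    then obtain y where y: "y \<in> model_chamber G S"
      "davis_proj G S (\<gamma>, y) = davis_proj G S (\<gamma> \<otimes> s, segment_to_center x t)"
      by (auto simp: chamber_def)
    then have "y = segment_to_center x t" "\<forall>\<sigma>\<in>supp y. s \<in> generate G \<sigma>"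
      using davis_proj_eq_iff[of \<gamma> "\<gamma> \<otimes> s" y "segment_to_center x t"] adj \<gamma> s
        segment_in_model_chamber[OF x(1), of t] t by auto
    then have "s \<in> generate G {}" using empty_in_supp_segment[OF x(1)] t by blast
    then show False using s S_neq_one by (simp add: generate_empty)
  qed
  then show "P \<in> halfspace r \<gamma>" using x refl \<gamma> by (simp add: proj_in_halfspace_iff)
qed


section \<open>The resolution by parity\<close>

text \<open>This is where the hypothesis on the coloring enters: reflections in one finite dihedral residue
  have intersecting walls, so that at most one of them has a given color.\<close>

lemma isolated_color_class:
  fixes \<phi> :: "'a davis_point set \<Rightarrow> 'c"
  assumes disj: "\<And>M M'. M \<in> walls G S \<Longrightarrow> M' \<in> walls G S \<Longrightarrow> M \<noteq> M' \<Longrightarrow> \<phi> M = \<phi> M' \<Longrightarrow> M \<inter> M' = {}"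
  shows "isolated (\<lambda>r. r \<in> reflections G S \<and> \<phi> (wall G S r) = c)"
  unfolding isolated_def
proof (intro ballI impI, elim conjE)
  fix \<gamma> s t x y
  assume a: "\<gamma> \<in> carrier G" "s \<in> S" "t \<in> S" "finite (generate G {s, t})"
    "x \<in> generate G {s, t}" "y \<in> generate G {s, t}"
    and x: "\<gamma> \<otimes> x \<otimes> inv \<gamma> \<in> reflections G S" "\<phi> (wall G S (\<gamma> \<otimes> x \<otimes> inv \<gamma>)) = c"
    and y: "\<gamma> \<otimes> y \<otimes> inv \<gamma> \<in> reflections G S" "\<phi> (wall G S (\<gamma> \<otimes> y \<otimes> inv \<gamma>)) = c"
  have "wall G S (\<gamma> \<otimes> x \<otimes> inv \<gamma>) = wall G S (\<gamma> \<otimes> y \<otimes> inv \<gamma>)"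
    using residue_walls_meet[OF a] disj[of "wall G S (\<gamma> \<otimes> x \<otimes> inv \<gamma>)" "wall G S (\<gamma> \<otimes> y \<otimes> inv \<gamma>)"] x y
    by (auto simp: walls_def)
  then have eq: "\<gamma> \<otimes> x \<otimes> inv \<gamma> = \<gamma> \<otimes> y \<otimes> inv \<gamma>" using wall_inj x y by blast
  have c: "x \<in> carrier G" "y \<in> carrier G" using a generate_subset_carrier[of "{s, t}"] by auto
  then have "\<gamma> \<otimes> x \<otimes> inv \<gamma> \<otimes> \<gamma> = \<gamma> \<otimes> y \<otimes> inv \<gamma> \<otimes> \<gamma>" by (simp only: eq)
  then show "x = y" using a(1) c by (simp add: m_assoc)
qed

text \<open>The labels are derived from levels \<open>h\<close>, one bit for each color and chamber. The chambers are
  restricted to a set \<open>D\<close> because a limit tiling inherits levels from translates of the original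
  tiling, and these depend on the finite piece that is compared.\<close>

definition two_level_on :: "'c set \<Rightarrow> ('a, 'c signed) tiling \<Rightarrow> 'a set \<Rightarrow> ('c \<Rightarrow> 'a \<Rightarrow> bool) \<Rightarrow> bool" where
  "two_level_on F \<beta> D h \<longleftrightarrow> (\<forall>\<gamma>\<in>D. \<forall>s\<in>S. \<exists>c\<in>F. \<beta> \<gamma> s = (if h c \<gamma> then Plus c else Minus c) \<and>
     (\<forall>c'. h c' (\<gamma> \<otimes> s) = (h c' \<gamma> \<noteq> (c' = c))))"

text \<open>The level of a chamber for the color \<open>c\<close> is the parity of the number of walls of color \<open>c\<close>
  between it and the base chamber, and a face gets the sign of that level. By
  \<open>parity_constant_along_wall\<close> all chambers touching one side of a wall of color \<open>c\<close> have the
  same level, so these signs come from an orientation: the left side is the one whose adjacent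
  chambers are on the upper level.\<close>

lemma exists_parity_resolution:
  fixes \<phi> :: "'a davis_point set \<Rightarrow> 'c"
  assumes \<phi>: "\<phi> \<in> walls G S \<rightarrow> F"
    and disj: "\<And>M M'. M \<in> walls G S \<Longrightarrow> M' \<in> walls G S \<Longrightarrow> M \<noteq> M' \<Longrightarrow> \<phi> M = \<phi> M' \<Longrightarrow> M \<inter> M' = {}"
  shows "\<exists>\<beta> h. geometric_resolution G S \<phi> \<beta> \<and> two_level_on F \<beta> (carrier G) h"
proof -
  define K where "K c r \<longleftrightarrow> r \<in> reflections G S \<and> \<phi> (wall G S r) = c" for c r
  have isol: "isolated (K c)" for c
    unfolding K_def[abs_def] using disj by (rule isolated_color_class)
  have "\<forall>c. \<exists>h :: 'a \<Rightarrow> bool. \<forall>\<gamma>\<in>carrier G. \<forall>s\<in>S. (h (\<gamma> \<otimes> s) \<noteq> h \<gamma>) = K c (\<gamma> \<otimes> s \<otimes> inv \<gamma>)"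
    using isolated_parity[OF isol] by blast
  then obtain h :: "'c \<Rightarrow> 'a \<Rightarrow> bool" where h:
    "\<And>c \<gamma> s. \<gamma> \<in> carrier G \<Longrightarrow> s \<in> S \<Longrightarrow> (h c (\<gamma> \<otimes> s) \<noteq> h c \<gamma>) = K c (\<gamma> \<otimes> s \<otimes> inv \<gamma>)"
    by metis
  define \<beta> where "\<beta> \<gamma> s = (let c = coloring_tiling G S \<phi> \<gamma> s in if h c \<gamma> then Plus c else Minus c)"
    for \<gamma> s
  have "two_level_on F \<beta> (carrier G) h"
    unfolding two_level_on_def
  proof (intro ballI)
    fix \<gamma> s assume \<gamma>: "\<gamma> \<in> carrier G" "s \<in> S"
    define c where "c = coloring_tiling G S \<phi> \<gamma> s"
    have refl: "\<gamma> \<otimes> s \<otimes> inv \<gamma> \<in> reflections G S" using \<gamma> reflectionI by blast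
    then have K: "K c' (\<gamma> \<otimes> s \<otimes> inv \<gamma>) \<longleftrightarrow> c' = c" for c'
      by (auto simp: K_def c_def coloring_tiling_def face_wall_def)
    have "c \<in> F"
      using refl \<phi> by (auto simp: c_def coloring_tiling_def face_wall_def walls_def)
    moreover have "h c' (\<gamma> \<otimes> s) = (h c' \<gamma> \<noteq> (c' = c))" for c'
      using h[OF \<gamma>, of c'] K by blast
    ultimately show "\<exists>c\<in>F. \<beta> \<gamma> s = (if h c \<gamma> then Plus c else Minus c) \<and>
        (\<forall>c'. h c' (\<gamma> \<otimes> s) = (h c' \<gamma> \<noteq> (c' = c)))"
      by (intro bexI[of _ c]) (auto simp: \<beta>_def c_def Let_def)
  qed
  moreover have "geometric_resolution G S \<phi> \<beta>"
  proof -
    \<comment> \<open>Of the two chambers at a face in the wall of \<open>r\<close>, exactly one is on the upper level.\<close>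
    have "\<exists>p\<in>carrier G. \<exists>s\<in>S. p \<otimes> s \<otimes> inv p = r \<and> h (\<phi> (wall G S r)) p"
      if r: "r \<in> reflections G S" for r
    proof -
      obtain w s where w: "w \<in> carrier G" "s \<in> S" "r = w \<otimes> s \<otimes> inv w"
        using r by (rule reflectionE)
      have "K (\<phi> (wall G S r)) r" using r by (simp add: K_def)
      then have "h (\<phi> (wall G S r)) (w \<otimes> s) \<noteq> h (\<phi> (wall G S r)) w"
        using h[OF w(1,2)] w(3) by simp
      moreover have "(w \<otimes> s) \<otimes> s \<otimes> inv (w \<otimes> s) = r"
      proof -
        have "w \<otimes> s = r \<otimes> w" using w by (simp add: m_assoc)
        then show ?thesis
          using mirror_conj_iff[OF w(1) S_in_carrier[OF w(2)] reflection_carrier[OF r]] w(3) by simp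
      qed
      ultimately show ?thesis using w by (metis S_in_carrier m_closed)
    qed
    then obtain p where p: "\<And>r. r \<in> reflections G S \<Longrightarrow> p r \<in> carrier G \<and>
        (\<exists>s\<in>S. p r \<otimes> s \<otimes> inv p r = r) \<and> h (\<phi> (wall G S r)) (p r)" by metis
    define \<rho> where "\<rho> M = (SOME r. r \<in> reflections G S \<and> wall G S r = M)" for M
    have \<rho>: "\<rho> (wall G S r) = r" if "r \<in> reflections G S" for r
      unfolding \<rho>_def using that wall_inj by (intro some_equality) auto
    define left where "left M = halfspace (\<rho> M) (p (\<rho> M))" for M
    define right where "right M = halfspace (\<rho> M) (\<rho> M \<otimes> p (\<rho> M))" for M
    have "wall_orientation G S left right"
      unfolding wall_orientation_def
    proof
      fix M assume "M \<in> walls G S"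
      then obtain r where r: "r \<in> reflections G S" "M = wall G S r" by (auto simp: walls_def)
      then show "left M \<noteq> right M \<and> connected_components_of
          (subtopology (davis_topology G S) (davis_complex G S - M)) = {left M, right M}"
        using p[OF r(1)] halfspace_mirror_neq[OF r(1)] connected_components_off_wall[OF r(1)]
        by (simp add: left_def right_def \<rho>)
    qed
    moreover have "davis_topology G S interior_of chamber G S \<gamma> \<subseteq> left (face_wall G S \<gamma> s) \<and>
          \<beta> \<gamma> s = Plus (coloring_tiling G S \<phi> \<gamma> s) \<or>
        davis_topology G S interior_of chamber G S \<gamma> \<subseteq> right (face_wall G S \<gamma> s) \<and>
          \<beta> \<gamma> s = Minus (coloring_tiling G S \<phi> \<gamma> s)"
      if \<gamma>: "\<gamma> \<in> carrier G" "s \<in> S" for \<gamma> s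
    proof -
      define r where "r = \<gamma> \<otimes> s \<otimes> inv \<gamma>"
      have r: "r \<in> reflections G S" unfolding r_def using \<gamma> reflectionI by blast
      define c where "c = \<phi> (wall G S r)"
      obtain s' where s': "s' \<in> S" "p r \<otimes> s' \<otimes> inv p r = r" and pr: "p r \<in> carrier G" "h c (p r)"
        using p[OF r] unfolding c_def by blast
      have Kr: "K c r" using r by (simp add: K_def c_def)
      have const: "h c \<delta> \<longleftrightarrow> h c (p r)"
        if "\<delta> \<in> carrier G" "\<delta> \<otimes> s \<otimes> inv \<delta> = r" "side r \<delta> = side r (p r)" for \<delta>
        using parity_constant_along_wall[OF isol[of c] h r Kr that(1) \<gamma>(2) that(2) pr(1) s' that(3)]
        by blast
      have rs: "\<gamma> \<otimes> s = r \<otimes> \<gamma>" using \<gamma> r conj_eq_iff r_def by auto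
      have "(\<gamma> \<otimes> s) \<otimes> s \<otimes> inv (\<gamma> \<otimes> s) = r"
        unfolding rs using \<gamma> r mirror_conj_iff r_def by auto
      moreover have "side r (\<gamma> \<otimes> s) \<noteq> side r \<gamma>" "h c (\<gamma> \<otimes> s) \<noteq> h c \<gamma>"
        using side_changes_iff[OF \<gamma>] h[OF \<gamma>, of c] Kr by (simp_all add: r_def)
      ultimately have iff: "h c \<gamma> \<longleftrightarrow> side r \<gamma> = side r (p r)"
        using const[of \<gamma>] const[of "\<gamma> \<otimes> s"] \<gamma> pr(2) by (auto simp: r_def)
      have lr: "left (face_wall G S \<gamma> s) = halfspace r (p r)"
        "right (face_wall G S \<gamma> s) = halfspace r (r \<otimes> p r)"
        using \<rho>[OF r] by (simp_all add: left_def right_def face_wall_def r_def)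
      have \<beta>: "\<beta> \<gamma> s = (if h c \<gamma> then Plus (coloring_tiling G S \<phi> \<gamma> s)
          else Minus (coloring_tiling G S \<phi> \<gamma> s))"
        by (simp add: \<beta>_def c_def r_def coloring_tiling_def face_wall_def)
      have int: "davis_topology G S interior_of chamber G S \<gamma> \<subseteq> halfspace r \<gamma>"
        using interior_chamber_subset_halfspace[OF \<gamma> r_def] .
      show ?thesis
      proof (cases "h c \<gamma>")
        case True
        then have "halfspace r \<gamma> = halfspace r (p r)" using iff halfspace_cong by blast
        then show ?thesis using True int \<beta> lr by simp
      next
        case False
        then have "halfspace r \<gamma> = halfspace r (r \<otimes> p r)"
          using iff side_mirror[OF r pr(1)] by (intro halfspace_cong) blast
        then show ?thesis using False int \<beta> lr by simp
      qed
    qed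
    ultimately show ?thesis unfolding geometric_resolution_def by blast
  qed
  ultimately show ?thesis by blast
qed


section \<open>Strict balance of two-level tilings\<close>

lemma weight_eq_height_difference:
  fixes W :: "'c \<Rightarrow> int" and h :: "'c \<Rightarrow> 'a \<Rightarrow> bool"
  assumes "finite F" "c \<in> F" "\<And>c'. h c' \<delta> = (h c' \<gamma> \<noteq> (c' = c))"
  defines "H \<equiv> \<lambda>\<gamma>. \<Sum>c\<in>F. if h c \<gamma> then W c else 0"
  shows "H \<gamma> - H \<delta> = (if h c \<gamma> then W c else - W c)"
proof -
  have "H \<gamma> - H \<delta> = (\<Sum>c'\<in>F. if c' = c then (if h c \<gamma> then W c else - W c) else 0)"
    unfolding H_def sum_subtractf[symmetric] using assms(3) by (intro sum.cong) auto
  then show ?thesis using assms(1,2) by simp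
qed

text \<open>Let \<open>H \<gamma>\<close> be the sum of the weights \<open>W c\<close> over the colors \<open>c\<close> for which \<open>\<gamma>\<close> is on the upper
  level. The weight of a face is the drop of \<open>H\<close> across it, so the weight of a tile is minus the
  discrete Laplacian of \<open>H\<close>. If no tile had positive weight, every chamber with a lower neighbor
  would also have a higher one, and one could climb forever although \<open>H\<close> is bounded. The bound
  depends only on \<open>W\<close>, so that levels are needed just on a finite piece of a climbing path. This is
  what makes the argument apply to limit tilings, whose levels are known only piecewise.\<close>

lemma exists_positive_tile:
  fixes \<beta> :: "('a, 'c signed) tiling"
  assumes F: "finite F"
    and loc: "\<And>D. finite D \<Longrightarrow> D \<subseteq> carrier G \<Longrightarrow> \<exists>h. two_level_on F \<beta> D h"
    and w: "weight_function (labels_of S (tiles_of G S \<beta>)) w"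
    and nz: "f \<in> labels_of S (tiles_of G S \<beta>)" "w f \<noteq> 0"
  shows "\<exists>t\<in>tiles_of G S \<beta>. (\<Sum>s\<in>S. w (t s)) > 0"
proof (rule ccontr)
  define L where "L = labels_of S (tiles_of G S \<beta>)"
  have L: "l \<in> L \<longleftrightarrow> (\<exists>\<gamma>\<in>carrier G. \<exists>s\<in>S. l = \<beta> \<gamma> s)" for l
    by (auto simp: L_def labels_of_def tiles_of_def)
  assume "\<not> ?thesis"
  then have neg: "(\<Sum>s\<in>S. w (\<beta> \<gamma> s)) \<le> 0" if "\<gamma> \<in> carrier G" for \<gamma>
    using that by (fastforce simp: tiles_of_def)
  have opp: "\<beta> (\<gamma> \<otimes> s) s = opp (\<beta> \<gamma> s)" if \<gamma>: "\<gamma> \<in> carrier G" "s \<in> S" for \<gamma> s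
  proof -
    obtain h where h: "two_level_on F \<beta> {\<gamma>, \<gamma> \<otimes> s} h"
      using loc[of "{\<gamma>, \<gamma> \<otimes> s}"] \<gamma> by auto
    then obtain c where c: "\<beta> \<gamma> s = (if h c \<gamma> then Plus c else Minus c)"
      "\<And>c'. h c' (\<gamma> \<otimes> s) = (h c' \<gamma> \<noteq> (c' = c))"
      using \<gamma> unfolding two_level_on_def by blast
    from h obtain d where d: "\<beta> (\<gamma> \<otimes> s) s = (if h d (\<gamma> \<otimes> s) then Plus d else Minus d)"
      "\<And>c'. h c' (\<gamma> \<otimes> s \<otimes> s) = (h c' (\<gamma> \<otimes> s) \<noteq> (c' = d))"
      using \<gamma> unfolding two_level_on_def by blast
    have "c = d" using c(2)[of c] d(2)[of c] \<gamma> by auto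
    then show ?thesis using c d by auto
  qed
  have w_opp: "w (\<beta> (\<gamma> \<otimes> s) s) = - w (\<beta> \<gamma> s)" if "\<gamma> \<in> carrier G" "s \<in> S" for \<gamma> s
    using opp[OF that] w that L unfolding weight_function_def L_def by metis
  \<comment> \<open>Colors that do not occur get weight \<open>0\<close>; only occurring labels are known to satisfy
    \<open>w (opp l) = - w l\<close>.\<close>
  define W where "W c = (if Plus c \<in> L then w (Plus c) else 0)" for c
  have W: "w (\<beta> \<gamma> s) = (if b then W c else - W c)"
    if "\<gamma> \<in> carrier G" "s \<in> S" "\<beta> \<gamma> s = (if b then Plus c else Minus c)" for \<gamma> s b c
  proof (cases b)
    case True
    then have "Plus c \<in> L"
      unfolding L using that by (intro bexI[of _ \<gamma>] bexI[of _ s]) simp_all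
    then show ?thesis using True that by (simp add: W_def)
  next
    case False
    then have "\<beta> (\<gamma> \<otimes> s) s = Plus c" using opp that by simp
    then have "Plus c \<in> L"
      unfolding L using that by (intro bexI[of _ "\<gamma> \<otimes> s"] bexI[of _ s]) simp_all
    then show ?thesis
      using False w_opp[OF that(1,2)] \<open>\<beta> (\<gamma> \<otimes> s) s = Plus c\<close> by (simp add: W_def)
  qed
  define B where "B = (\<Sum>c\<in>F. \<bar>W c\<bar>)"
  \<comment> \<open>Behind a face of negative weight lies a higher chamber, which has a lower neighbor and hence also
    a higher one.\<close>
  have climb: "\<exists>s'\<in>S. w (\<beta> (\<gamma> \<otimes> s) s') < 0"
    if \<gamma>: "\<gamma> \<in> carrier G" "s \<in> S" "w (\<beta> \<gamma> s) < 0" for \<gamma> s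
  proof (rule ccontr)
    assume "\<not> ?thesis"
    then have "0 \<le> w (\<beta> (\<gamma> \<otimes> s) s')" if "s' \<in> S" for s' using that by force
    moreover have "0 < w (\<beta> (\<gamma> \<otimes> s) s)" using w_opp \<gamma> by simp
    ultimately have "0 < (\<Sum>s'\<in>S. w (\<beta> (\<gamma> \<otimes> s) s'))"
      using finite_S \<gamma>(2) by (intro sum_pos2) auto
    then show False using neg[of "\<gamma> \<otimes> s"] \<gamma> by simp
  qed
  obtain \<gamma>0 s0 where start: "\<gamma>0 \<in> carrier G" "s0 \<in> S" "w (\<beta> \<gamma>0 s0) < 0"
  proof -
    obtain \<gamma> s where \<gamma>: "\<gamma> \<in> carrier G" "s \<in> S" "f = \<beta> \<gamma> s"
      using nz(1) L L_def by blast
    consider "w (\<beta> \<gamma> s) < 0" | "w (\<beta> (\<gamma> \<otimes> s) s) < 0"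
      using nz(2) \<gamma> w_opp by fastforce
    then show thesis using \<gamma> that[of \<gamma> s] that[of "\<gamma> \<otimes> s" s] by cases auto
  qed
  have "\<exists>q. \<forall>n. (fst (q n) \<in> carrier G \<and> snd (q n) \<in> S \<and> w (\<beta> (fst (q n)) (snd (q n))) < 0) \<and>
      fst (q (Suc n)) = fst (q n) \<otimes> snd (q n)"
  proof (rule dependent_nat_choice)
    show "\<exists>x. fst x \<in> carrier G \<and> snd x \<in> S \<and> w (\<beta> (fst x) (snd x)) < 0"
      using start by (intro exI[of _ "(\<gamma>0, s0)"]) simp
    fix x :: "'a \<times> 'a"
    assume x: "fst x \<in> carrier G \<and> snd x \<in> S \<and> w (\<beta> (fst x) (snd x)) < 0"
    then obtain s' where "s' \<in> S" "w (\<beta> (fst x \<otimes> snd x) s') < 0" using climb by blast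
    then show "\<exists>y. (fst y \<in> carrier G \<and> snd y \<in> S \<and> w (\<beta> (fst y) (snd y)) < 0) \<and>
        fst y = fst x \<otimes> snd x"
      using x by (intro exI[of _ "(fst x \<otimes> snd x, s')"]) simp
  qed
  then obtain q where q: "\<And>n. fst (q n) \<in> carrier G" "\<And>n. snd (q n) \<in> S"
    "\<And>n. w (\<beta> (fst (q n)) (snd (q n))) < 0" "\<And>n. fst (q (Suc n)) = fst (q n) \<otimes> snd (q n)"
    by blast
  \<comment> \<open>All heights lie between \<open>- B\<close> and \<open>B\<close>, so more than \<open>2 * B\<close> steps upwards are impossible.\<close>
  define N where "N = nat (2 * B + 1)"
  obtain h where h: "two_level_on F \<beta> ((\<lambda>n. fst (q n)) ` {..N}) h"
    using loc[of "(\<lambda>n. fst (q n)) ` {..N}"] q(1) by auto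
  define H where "H \<gamma> = (\<Sum>c\<in>F. if h c \<gamma> then W c else 0)" for \<gamma>
  have bound: "\<bar>H \<gamma>\<bar> \<le> B" for \<gamma>
    unfolding H_def B_def by (rule order_trans[OF sum_abs]) (auto intro: sum_mono)
  have up: "H (fst (q n)) < H (fst (q (Suc n)))" if n: "n \<le> N" for n
  proof -
    obtain c where c: "c \<in> F" "\<beta> (fst (q n)) (snd (q n)) = (if h c (fst (q n)) then Plus c else Minus c)"
      "\<And>c'. h c' (fst (q (Suc n))) = (h c' (fst (q n)) \<noteq> (c' = c))"
      using h n q(2)[of n] q(4)[of n] unfolding two_level_on_def by (metis (no_types, lifting) atMost_iff image_eqI)
    have "H (fst (q n)) - H (fst (q (Suc n))) = (if h c (fst (q n)) then W c else - W c)"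
      unfolding H_def by (rule weight_eq_height_difference[OF F c(1,3)])
    also have "\<dots> = w (\<beta> (fst (q n)) (snd (q n)))"
      using W[OF q(1,2) c(2)] by simp
    finally show ?thesis using q(3)[of n] by simp
  qed
  have "H (fst (q 0)) + int n \<le> H (fst (q n))" if "n \<le> Suc N" for n
    using that
  proof (induction n)
    case (Suc n)
    then show ?case using up[of n] by simp
  qed simp
  from this[of "Suc N"] have "H (fst (q 0)) + int (Suc N) \<le> H (fst (q (Suc N)))" by simp
  moreover have "0 \<le> B" unfolding B_def by (simp add: sum_nonneg)
  ultimately show False
    using bound[of "fst (q 0)"] bound[of "fst (q (Suc N))"] by (simp add: N_def)
qed

lemma locally_two_level_strictly_balanced:
  fixes \<beta> :: "('a, 'c signed) tiling"
  assumes "finite F"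
    and "\<And>D. finite D \<Longrightarrow> D \<subseteq> carrier G \<Longrightarrow> \<exists>h. two_level_on F \<beta> D h"
  shows "strictly_balanced_tiling G S \<beta>"
  unfolding strictly_balanced_tiling_def strictly_balanced_def
proof (intro allI impI, elim conjE bexE)
  fix w f
  assume w: "weight_function (labels_of S (tiles_of G S \<beta>)) w"
    and f: "f \<in> labels_of S (tiles_of G S \<beta>)" "w f \<noteq> 0"
  have "weight_function (labels_of S (tiles_of G S \<beta>)) (\<lambda>l. - w l)"
    using w by (simp add: weight_function_def)
  from exists_positive_tile[OF assms this f(1)] f(2)
  have "\<exists>t\<in>tiles_of G S \<beta>. (\<Sum>s\<in>S. w (t s)) < 0" by (simp add: sum_negf)
  then show "(\<exists>t\<in>tiles_of G S \<beta>. (\<Sum>s\<in>S. w (t s)) > 0) \<and>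
      (\<exists>t\<in>tiles_of G S \<beta>. (\<Sum>s\<in>S. w (t s)) < 0)"
    using exists_positive_tile[OF assms w f] by simp
qed


section \<open>Limit tilings\<close>

text \<open>The centers of finitely many chambers lie in a common ball around the center of the base
  chamber.\<close>

lemma limit_tiling_coincides_on_finite:
  assumes lim: "limit_tiling G S \<alpha> \<beta>" and D: "finite D" "D \<subseteq> carrier G"
  shows "\<exists>g\<in>carrier G. \<forall>\<gamma>\<in>D. \<forall>s\<in>S. \<beta> \<gamma> s = \<alpha> (inv g \<otimes> \<gamma>) s"
proof -
  obtain g where g: "\<And>n. g n \<in> carrier G" "tiling_converges G S (\<lambda>n. tiling_act G (g n) \<alpha>) \<beta>"
    using lim by (auto simp: limit_tiling_def)
  let ?P = "davis_proj G S (\<one>, center)"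
  have "\<exists>l. \<forall>\<gamma>\<in>D. davis_dist G S ?P (davis_proj G S (\<gamma>, center)) \<le> l"
    using D(1) by (intro exI[of _ "Max ((\<lambda>\<gamma>. davis_dist G S ?P (davis_proj G S (\<gamma>, center))) ` D)"]) auto
  then obtain l where l: "\<And>\<gamma>. \<gamma> \<in> D \<Longrightarrow> davis_dist G S ?P (davis_proj G S (\<gamma>, center)) \<le> l" by blast
  have "?P \<in> davis_complex G S" by (simp add: davis_proj_in_complex)
  then have "\<forall>\<^sub>F n in sequentially. coincide_on G S (davis_ball G S ?P l) (tiling_act G (g n) \<alpha>) \<beta>"
    using g(2) by (auto simp: tiling_converges_def)
  then obtain n where n: "coincide_on G S (davis_ball G S ?P l) (tiling_act G (g n) \<alpha>) \<beta>"
    by (auto simp: eventually_sequentially)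
  have "\<beta> \<gamma> s = \<alpha> (inv (g n) \<otimes> \<gamma>) s" if "\<gamma> \<in> D" "s \<in> S" for \<gamma> s
  proof -
    have "davis_proj G S (\<gamma>, center) \<in> chamber G S \<gamma> \<inter> davis_ball G S ?P l"
      using that D l by (auto simp: davis_ball_def chamber_def davis_proj_in_complex)
    then show ?thesis using n that D by (auto simp: coincide_on_def tiling_act_def)
  qed
  then show ?thesis using g(1) by blast
qed

lemma limit_tiling_locally_two_level:
  assumes \<alpha>: "two_level_on F \<alpha> (carrier G) h" and lim: "limit_tiling G S \<alpha> \<beta>"
    and D: "finite D" "D \<subseteq> carrier G"
  shows "\<exists>h. two_level_on F \<beta> D h"
proof -
  obtain g where g: "g \<in> carrier G" "\<forall>\<gamma>\<in>D. \<forall>s\<in>S. \<beta> \<gamma> s = \<alpha> (inv g \<otimes> \<gamma>) s"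
    using limit_tiling_coincides_on_finite[OF lim D] by blast
  have "two_level_on F \<beta> D (\<lambda>c \<gamma>. h c (inv g \<otimes> \<gamma>))"
    unfolding two_level_on_def
  proof (intro ballI)
    fix \<gamma> s assume \<gamma>: "\<gamma> \<in> D" "s \<in> S"
    then have "inv g \<otimes> \<gamma> \<in> carrier G" "inv g \<otimes> (\<gamma> \<otimes> s) = inv g \<otimes> \<gamma> \<otimes> s"
      using g D by (auto simp: m_assoc)
    then show "\<exists>c\<in>F. \<beta> \<gamma> s = (if h c (inv g \<otimes> \<gamma>) then Plus c else Minus c) \<and>
        (\<forall>c'. h c' (inv g \<otimes> (\<gamma> \<otimes> s)) = (h c' (inv g \<otimes> \<gamma>) \<noteq> (c' = c)))"
      using \<alpha> \<gamma> g(2) unfolding two_level_on_def by auto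
  qed
  then show ?thesis by blast
qed

end


section \<open>Strictly balanced geometric resolutions\<close>

theorem theorem6:
  fixes k :: nat and m :: "nat \<Rightarrow> nat \<Rightarrow> nat"
    and \<phi> :: "nat word set davis_point set \<Rightarrow> 'c" and F :: "'c set"
  defines "G \<equiv> coxeter_group k m" and "S \<equiv> coxeter_gens k m"
  assumes "coxeter_matrix k m"
    and "finite F" and "\<phi> \<in> walls G S \<rightarrow> F"
    and "\<And>M M'. M \<in> walls G S \<Longrightarrow> M' \<in> walls G S \<Longrightarrow> M \<noteq> M' \<Longrightarrow> \<phi> M = \<phi> M' \<Longrightarrow> M \<inter> M' = {}"
  shows "\<exists>\<phi>'. geometric_resolution G S \<phi> \<phi>' \<and>
           strictly_balanced_tiling G S \<phi>' \<and>
           (\<forall>\<beta>. limit_tiling G S \<phi>' \<beta> \<longrightarrow> strictly_balanced_tiling G S \<beta>)"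
proof -
  interpret gallery_group G S
    unfolding G_def S_def using assms(3) by (rule gallery_group_coxeter)
  obtain \<phi>' h where \<phi>': "geometric_resolution G S \<phi> \<phi>'" "two_level_on F \<phi>' (carrier G) h"
    using exists_parity_resolution[OF assms(5,6)] by blast
  have "two_level_on F \<phi>' D h" if "D \<subseteq> carrier G" for D
    using \<phi>'(2) that unfolding two_level_on_def by blast
  then have "strictly_balanced_tiling G S \<phi>'"
    using locally_two_level_strictly_balanced[OF assms(4)] by blast
  moreover have "strictly_balanced_tiling G S \<beta>" if "limit_tiling G S \<phi>' \<beta>" for \<beta>
    using locally_two_level_strictly_balanced[OF assms(4)]
      limit_tiling_locally_two_level[OF \<phi>'(2) that] by blast
  ultimately show ?thesis using \<phi>'(1) by blast
qed

end
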